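(* Let $t\in\mathbb{N}$, let $\Omega=\{1,\dots,n\}$ and let $f:2^\Omega\to\mathbb{R}$ be a set function of degree $d$. (a) If $t<\lceil\frac{d-2}{2}\rceil$, then $f$ is not $t$-sos-submodular. (b) If $t=\lceil\frac{n+d-5}{2}\rceil$, then the set of $t$-sos-submodular set functions on $2^\Omega$ of degree $d$ is exactly the set of submodular set functions on $2^\Omega$ of degree $d$.
   Context: $\mathbb{N}$ includes $0$. A set function $f:2^\Omega\to\mathbb{R}$ is submodular if $f(S)+f(T)\ge f(S\cup T)+f(S\cap T)$ for all $S,T\subseteq\Omega$. The multilinear extension (MLE) of $f$ is the unique multilinear polynomial $F\in\mathbb{R}[x_1,\dots,x_n]$ (every variable appears with power at most $1$ in every monomial) with $F(1_S)=f(S)$ for all $S\subseteq\Omega$, where $1_S\in\{0,1\}^n$ is the indicator vector of $S$. The degree of $f$ is the degree of $F$. For an ideal $I$ of a real polynomial ring, a polynomial $p$ is $t$-sos modulo $I$ if there are finitely many polynomials $q_1,\dots,q_m$ in that ring, each of degree at most $t$, with $p-\sum_{r=1}^m q_r^2\in I$. For $i\ne j$, $x_{-i,j}$ denotes the variables $x_1,\dots,x_n$ with $x_i,x_j$ removed, and $I_2[x_{-i,j}]=\langle x_k^2-x_k : k\neq i,j\rangle\subseteq\mathbb{R}[x_{-i,j}]$. The set function $f$ with MLE $F$ is $t$-sos-submodular if for all $i\neq j$ in $\{1,\dots,n\}$ the polynomial $-\frac{\partial^2F(x)}{\partial x_i\partial x_j}$ (which does not involve $x_i,x_j$) is $t$-sos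 modulo $I_2[x_{-i,j}]$. *)

theory Defs
  imports "HOL-Library.Poly_Mapping" "HOL-Library.FuncSet" "HOL-Library.Indicator_Function"
    "HOL-Algebra.Ideal" Complex_Main
begin

text \<open>A real polynomial in the variables \<open>x\<^sub>k\<close> (\<open>k :: nat\<close>) is a finitely supported map from
  monomials (exponent vectors) to coefficients; the ring operations are those of
  \<^theory>\<open>HOL-Library.Poly_Mapping\<close>.\<close>

type_synonym monomial = "nat \<Rightarrow>\<^sub>0 nat"
type_synonym real_mpoly = "monomial \<Rightarrow>\<^sub>0 real"

definition Var :: "nat \<Rightarrow> real_mpoly" where
  "Var k = Poly_Mapping.single (Poly_Mapping.single k 1) 1"

definition vars :: "real_mpoly \<Rightarrow> nat set" where
  "vars p = (\<Union>m\<in>Poly_Mapping.keys p. Poly_Mapping.keys m)"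

definition monomial_degree :: "monomial \<Rightarrow> nat" where
  "monomial_degree m = (\<Sum>k\<in>Poly_Mapping.keys m. Poly_Mapping.lookup m k)"

text \<open>Total degree; the zero polynomial is given degree \<open>0\<close>.\<close>

definition total_degree :: "real_mpoly \<Rightarrow> nat" where
  "total_degree p = Max (insert 0 (monomial_degree ` Poly_Mapping.keys p))"

definition poly_eval :: "real_mpoly \<Rightarrow> (nat \<Rightarrow> real) \<Rightarrow> real" where
  "poly_eval p x = (\<Sum>m\<in>Poly_Mapping.keys p. Poly_Mapping.lookup p m *
     (\<Prod>k\<in>Poly_Mapping.keys m. x k ^ Poly_Mapping.lookup m k))"

text \<open>Monomials not containing \<open>x\<^sub>i\<close> contribute with coefficient \<open>0\<close>, so the truncated subtraction
  of exponent vectors is harmless.\<close>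

definition partial_deriv :: "nat \<Rightarrow> real_mpoly \<Rightarrow> real_mpoly" where
  "partial_deriv i p = (\<Sum>m\<in>Poly_Mapping.keys p.
     Poly_Mapping.single (m - Poly_Mapping.single i 1)
       (real (Poly_Mapping.lookup m i) * Poly_Mapping.lookup p m))"

definition multilinear :: "real_mpoly \<Rightarrow> bool" where
  "multilinear p \<longleftrightarrow> (\<forall>m\<in>Poly_Mapping.keys p. \<forall>k. Poly_Mapping.lookup m k \<le> 1)"

text \<open>The polynomial ring \<open>\<real>[x\<^sub>k : k \<in> V]\<close>.\<close>

definition poly_ring :: "nat set \<Rightarrow> real_mpoly ring" where
  "poly_ring V = \<lparr>carrier = {p. vars p \<subseteq> V}, mult = (*), one = 1, zero = 0, add = (+)\<rparr>"

definition I2 :: "nat set \<Rightarrow> real_mpoly set" where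
  "I2 V = Idl\<^bsub>poly_ring V\<^esub> {Var k ^ 2 - Var k | k. k \<in> V}"

text \<open>\<open>p\<close> is \<open>t\<close>-sos modulo the ideal \<open>I\<close> of \<open>\<real>[x\<^sub>k : k \<in> V]\<close>.\<close>

definition sos_mod :: "nat set \<Rightarrow> real_mpoly set \<Rightarrow> nat \<Rightarrow> real_mpoly \<Rightarrow> bool" where
  "sos_mod V I t p \<longleftrightarrow> p \<in> carrier (poly_ring V) \<and>
     (\<exists>(m::nat) q. (\<forall>r\<in>{1..m}. q r \<in> carrier (poly_ring V) \<and> total_degree (q r) \<le> t) \<and>
        p - (\<Sum>r=1..m. q r ^ 2) \<in> I)"

text \<open>Set functions on the power set of \<open>{1..n}\<close>; they are extensional (\<^const>\<open>undefined\<close> outside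
  \<open>Pow {1..n}\<close>).\<close>

definition set_functions :: "nat \<Rightarrow> (nat set \<Rightarrow> real) set" where
  "set_functions n = (Pow {1..n} \<rightarrow>\<^sub>E UNIV)"

definition submodular :: "nat \<Rightarrow> (nat set \<Rightarrow> real) \<Rightarrow> bool" where
  "submodular n f \<longleftrightarrow> (\<forall>S T. S \<subseteq> {1..n} \<longrightarrow> T \<subseteq> {1..n} \<longrightarrow> f S + f T \<ge> f (S \<union> T) + f (S \<inter> T))"

definition is_mle :: "nat \<Rightarrow> (nat set \<Rightarrow> real) \<Rightarrow> real_mpoly \<Rightarrow> bool" where
  "is_mle n f F \<longleftrightarrow> F \<in> carrier (poly_ring {1..n}) \<and> multilinear F \<and>
     (\<forall>S\<subseteq>{1..n}. poly_eval F (indicator S) = f S)"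

definition mle :: "nat \<Rightarrow> (nat set \<Rightarrow> real) \<Rightarrow> real_mpoly" where
  "mle n f = (THE F. is_mle n f F)"

definition set_function_degree :: "nat \<Rightarrow> (nat set \<Rightarrow> real) \<Rightarrow> nat" where
  "set_function_degree n f = total_degree (mle n f)"

definition sos_submodular :: "nat \<Rightarrow> nat \<Rightarrow> (nat set \<Rightarrow> real) \<Rightarrow> bool" where
  "sos_submodular n t f \<longleftrightarrow> (\<forall>i\<in>{1..n}. \<forall>j\<in>{1..n}. i \<noteq> j \<longrightarrow>
     sos_mod ({1..n} - {i, j}) (I2 ({1..n} - {i, j})) t
       (- partial_deriv i (partial_deriv j (mle n f))))"


text \<open>\<^const>\<open>poly_ring\<close> is a commutative ring, and \<^const>\<open>I2\<close> is an ideal of it.\<close>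

lemma keys_add_nat: "Poly_Mapping.keys (a + b :: 'a \<Rightarrow>\<^sub>0 nat) = Poly_Mapping.keys a \<union> Poly_Mapping.keys b"
  by (auto simp: in_keys_iff lookup_add)

lemma vars_add: "vars p \<subseteq> V \<Longrightarrow> vars q \<subseteq> V \<Longrightarrow> vars (p + q) \<subseteq> V"
  unfolding vars_def using Poly_Mapping.keys_add[of p q] by blast

lemma vars_mult: "vars p \<subseteq> V \<Longrightarrow> vars q \<subseteq> V \<Longrightarrow> vars (p * q) \<subseteq> V"
  unfolding vars_def
proof (rule UN_least)
  fix m
  assume pq: "(\<Union>m\<in>Poly_Mapping.keys p. Poly_Mapping.keys m) \<subseteq> V"
    "(\<Union>m\<in>Poly_Mapping.keys q. Poly_Mapping.keys m) \<subseteq> V"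
  assume "m \<in> Poly_Mapping.keys (p * q)"
  then obtain a b where "m = a + b" "a \<in> Poly_Mapping.keys p" "b \<in> Poly_Mapping.keys q"
    using keys_mult[of p q] by blast
  then show "Poly_Mapping.keys m \<subseteq> V"
    using pq by (simp add: keys_add_nat UN_subset_iff)
qed

lemma vars_uminus [simp]: "vars (- p) = vars p"
  by (simp add: vars_def)

lemma vars_0 [simp]: "vars 0 = {}"
  by (simp add: vars_def)

lemma vars_1 [simp]: "vars 1 = {}"
  by (simp add: vars_def)

lemma vars_Var [simp]: "vars (Var k) = {k}"
  by (simp add: vars_def Var_def)

lemma cring_poly_ring: "cring (poly_ring V)"
proof (rule cringI)
  show "abelian_group (poly_ring V)"
  proof (rule abelian_groupI)
    fix x assume "x \<in> carrier (poly_ring V)"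
    then show "\<exists>y\<in>carrier (poly_ring V). y \<oplus>\<^bsub>poly_ring V\<^esub> x = \<zero>\<^bsub>poly_ring V\<^esub>"
      by (intro bexI[of _ "- x"]) (simp_all add: poly_ring_def)
  qed (simp_all add: poly_ring_def vars_add ac_simps)
  show "Group.comm_monoid (poly_ring V)"
    by (rule comm_monoidI) (simp_all add: poly_ring_def vars_mult ac_simps)
qed (simp add: poly_ring_def distrib_right)

lemma ideal_I2: "ideal (I2 V) (poly_ring V)"
proof -
  interpret cring "poly_ring V" by (rule cring_poly_ring)
  have "vars (Var k ^ 2 - Var k) \<subseteq> V" if "k \<in> V" for k
    using vars_add[of "Var k * Var k" V "- Var k"] vars_mult[of "Var k" V "Var k"] that
    by (simp add: power2_eq_square)
  then have "{Var k ^ 2 - Var k | k. k \<in> V} \<subseteq> carrier (poly_ring V)"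
    by (auto simp only: poly_ring_def partial_object.simps mem_Collect_eq)
  then show ?thesis
    unfolding I2_def by (rule genideal_ideal)
qed


text \<open>The multilinear extension exists and is unique, so the definite description in
  \<^const>\<open>mle\<close> is meaningful.\<close>

definition sqfree_monomial :: "nat set \<Rightarrow> monomial" where
  "sqfree_monomial S = (\<Sum>k\<in>S. Poly_Mapping.single k 1)"

lemma lookup_sqfree_monomial:
  "finite S \<Longrightarrow> Poly_Mapping.lookup (sqfree_monomial S) k = (if k \<in> S then 1 else 0)"
  by (simp add: sqfree_monomial_def lookup_sum lookup_single when_def)

lemma keys_sqfree_monomial: "finite S \<Longrightarrow> Poly_Mapping.keys (sqfree_monomial S) = S"
  by (auto simp: in_keys_iff lookup_sqfree_monomial split: if_splits)

lemma inj_sqfree_monomial: "finite A \<Longrightarrow> inj_on sqfree_monomial (Pow A)"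
  by (rule inj_onI) (metis PowD finite_subset keys_sqfree_monomial)

lemma sqfree_monomial_keys:
  assumes "\<And>k. Poly_Mapping.lookup m k \<le> 1"
  shows "sqfree_monomial (Poly_Mapping.keys m) = m"
proof (rule poly_mapping_eqI)
  fix k
  show "Poly_Mapping.lookup (sqfree_monomial (Poly_Mapping.keys m)) k = Poly_Mapping.lookup m k"
    using assms[of k] by (auto simp: lookup_sqfree_monomial in_keys_iff)
qed

lemma keys_multilinear:
  assumes "multilinear p" "vars p \<subseteq> A"
  shows "Poly_Mapping.keys p \<subseteq> sqfree_monomial ` Pow A"
proof
  fix m assume m: "m \<in> Poly_Mapping.keys p"
  then have "sqfree_monomial (Poly_Mapping.keys m) = m"
    using assms(1) by (intro sqfree_monomial_keys) (auto simp: multilinear_def)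
  moreover have "Poly_Mapping.keys m \<subseteq> A"
    using m assms(2) by (auto simp: vars_def)
  ultimately show "m \<in> sqfree_monomial ` Pow A" by (metis PowI imageI)
qed

lemma poly_eval_indicator:
  assumes "multilinear p" "vars p \<subseteq> A" "finite A" "T \<subseteq> A"
  shows "poly_eval p (indicator T) = (\<Sum>S\<in>Pow T. Poly_Mapping.lookup p (sqfree_monomial S))"
proof -
  have fin: "finite S" if "S \<subseteq> A" for S using that assms(3) by (rule finite_subset)
  have "poly_eval p (indicator T) = (\<Sum>m\<in>sqfree_monomial ` Pow A. Poly_Mapping.lookup p m *
     (\<Prod>k\<in>Poly_Mapping.keys m. indicator T k ^ Poly_Mapping.lookup m k))"
    unfolding poly_eval_def using assms(3) keys_multilinear[OF assms(1,2)]
    by (intro sum.mono_neutral_left) (auto simp: in_keys_iff)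
  also have "\<dots> = (\<Sum>S\<in>Pow A. Poly_Mapping.lookup p (sqfree_monomial S) *
     (\<Prod>k\<in>S. indicator T k))"
    by (subst sum.reindex[OF inj_sqfree_monomial[OF assms(3)]])
      (auto intro!: sum.cong prod.cong simp: fin keys_sqfree_monomial lookup_sqfree_monomial)
  also have "\<dots> = (\<Sum>S\<in>Pow T. Poly_Mapping.lookup p (sqfree_monomial S) *
     (\<Prod>k\<in>S. indicator T k))"
    using assms(3,4) by (intro sum.mono_neutral_right) (auto simp: fin indicator_def)
  also have "\<dots> = (\<Sum>S\<in>Pow T. Poly_Mapping.lookup p (sqfree_monomial S))"
    by (intro sum.cong refl) (auto simp: indicator_def prod.neutral subset_iff)
  finally show ?thesis .
qed

lemma multilinear_eqI:
  assumes p: "multilinear p" "vars p \<subseteq> A" and q: "multilinear q" "vars q \<subseteq> A"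
    and "finite A" and eq: "\<And>S. S \<subseteq> A \<Longrightarrow> poly_eval p (indicator S) = poly_eval q (indicator S)"
  shows "p = q"
proof -
  have *: "Poly_Mapping.lookup p (sqfree_monomial S) = Poly_Mapping.lookup q (sqfree_monomial S)"
    if "finite S" "S \<subseteq> A" for S
    using that
  proof (induction S rule: finite_psubset_induct)
    case (psubset S)
    have "(\<Sum>T\<in>Pow S. Poly_Mapping.lookup p (sqfree_monomial T)) =
          (\<Sum>T\<in>Pow S. Poly_Mapping.lookup q (sqfree_monomial T))"
      using eq[OF psubset.prems] poly_eval_indicator[OF p \<open>finite A\<close> psubset.prems]
        poly_eval_indicator[OF q \<open>finite A\<close> psubset.prems] by simp
    moreover have "(\<Sum>T\<in>Pow S - {S}. Poly_Mapping.lookup p (sqfree_monomial T)) =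
          (\<Sum>T\<in>Pow S - {S}. Poly_Mapping.lookup q (sqfree_monomial T))"
      using psubset by (intro sum.cong refl) blast
    ultimately show ?case
      using psubset.hyps by (simp add: sum.remove[of "Pow S" S])
  qed
  show ?thesis
  proof (rule poly_mapping_eqI)
    fix m
    show "Poly_Mapping.lookup p m = Poly_Mapping.lookup q m"
    proof (cases "m \<in> sqfree_monomial ` Pow A")
      case True
      then show ?thesis using * \<open>finite A\<close> finite_subset by blast
    next
      case False
      then show ?thesis
        using keys_multilinear[OF p] keys_multilinear[OF q] by (metis in_keys_iff subsetD)
    qed
  qed
qed

lemma multilinear_exists:
  assumes "finite A"
  shows "\<exists>p. multilinear p \<and> vars p \<subseteq> A \<and> (\<forall>S\<subseteq>A. poly_eval p (indicator S) = f S)"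
proof -
  have "\<exists>c :: nat set \<Rightarrow> real. \<forall>S\<subseteq>A. (\<Sum>T\<in>Pow S. c T) = f S"
    using assms
  proof (induction A arbitrary: f rule: finite_induct)
    case empty
    show ?case by (rule exI[of _ f]) auto
  next
    case (insert a A)
    obtain c where c: "\<And>S. S \<subseteq> A \<Longrightarrow> (\<Sum>T\<in>Pow S. c T) = f S"
      using insert.IH[of f] by blast
    obtain d where d: "\<And>S. S \<subseteq> A \<Longrightarrow> (\<Sum>T\<in>Pow S. d T) = f (insert a S) - f S"
      using insert.IH[of "\<lambda>S. f (insert a S) - f S"] by blast
    define e where "e S = (if a \<in> S then d (S - {a}) else c S)" for S
    have e1: "(\<Sum>T\<in>Pow S. e T) = f S" if "S \<subseteq> A" for S
    proof -
      have "(\<Sum>T\<in>Pow S. e T) = (\<Sum>T\<in>Pow S. c T)"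
        using that insert.hyps by (intro sum.cong) (auto simp: e_def)
      then show ?thesis using c that by simp
    qed
    have "(\<Sum>T\<in>Pow S. e T) = f S" if S: "S \<subseteq> insert a A" for S
    proof (cases "a \<in> S")
      case False
      then show ?thesis using e1 S by blast
    next
      case True
      define S' where "S' = S - {a}"
      have S': "S = insert a S'" "a \<notin> S'" "S' \<subseteq> A" "finite S'"
        using True S insert.hyps finite_subset[of S' A] by (auto simp: S'_def)
      have inj: "inj_on (insert a) (Pow S')"
        using S'(2) by (auto simp: inj_on_def)
      have "(\<Sum>T\<in>Pow S. e T) = (\<Sum>T\<in>Pow S'. e T) + (\<Sum>T\<in>insert a ` Pow S'. e T)"
        unfolding S'(1) Pow_insert using S'(2,4) by (intro sum.union_disjoint) auto
      also have "(\<Sum>T\<in>insert a ` Pow S'. e T) = (\<Sum>T\<in>Pow S'. d T)"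
        unfolding sum.reindex[OF inj]
      proof (intro sum.cong refl)
        fix T assume "T \<in> Pow S'"
        then have "a \<notin> T" using S'(2) by blast
        then show "(e \<circ> insert a) T = d T" by (simp add: e_def)
      qed
      finally show ?thesis using e1[OF S'(3)] d[OF S'(3)] S'(1) by simp
    qed
    then show ?case by blast
  qed
  then obtain c :: "nat set \<Rightarrow> real" where c: "\<And>S. S \<subseteq> A \<Longrightarrow> (\<Sum>T\<in>Pow S. c T) = f S"
    by blast
  have fin: "finite S" if "S \<subseteq> A" for S using that assms by (rule finite_subset)
  define p where "p = (\<Sum>S\<in>Pow A. Poly_Mapping.single (sqfree_monomial S) (c S))"
  have lookup_p: "Poly_Mapping.lookup p (sqfree_monomial S) = c S" if "S \<subseteq> A" for S
  proof -
    have "Poly_Mapping.lookup p (sqfree_monomial S) = (\<Sum>T\<in>Pow A. if T = S then c T else 0)"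
      unfolding p_def lookup_sum lookup_single when_def
      using that inj_onD[OF inj_sqfree_monomial[OF assms]] by (intro sum.cong refl) auto
    then show ?thesis using that assms by simp
  qed
  have keys_p: "Poly_Mapping.keys p \<subseteq> sqfree_monomial ` Pow A"
  proof
    fix m assume "m \<in> Poly_Mapping.keys p"
    then have "(\<Sum>S\<in>Pow A. c S when sqfree_monomial S = m) \<noteq> 0"
      by (simp add: p_def in_keys_iff lookup_sum lookup_single)
    then obtain S where "S \<in> Pow A" "(c S when sqfree_monomial S = m) \<noteq> 0"
      by (rule sum.not_neutral_contains_not_neutral)
    then show "m \<in> sqfree_monomial ` Pow A" by (auto simp: when_def split: if_splits)
  qed
  have "multilinear p"
    unfolding multilinear_def
  proof (intro ballI allI)
    fix m k assume "m \<in> Poly_Mapping.keys p"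
    then obtain S where "S \<subseteq> A" "m = sqfree_monomial S" using keys_p by blast
    then show "Poly_Mapping.lookup m k \<le> 1" using fin by (simp add: lookup_sqfree_monomial)
  qed
  moreover have "vars p \<subseteq> A"
    unfolding vars_def
  proof (rule UN_least)
    fix m assume "m \<in> Poly_Mapping.keys p"
    then obtain S where "S \<subseteq> A" "m = sqfree_monomial S" using keys_p by blast
    then show "Poly_Mapping.keys m \<subseteq> A" using fin by (simp add: keys_sqfree_monomial)
  qed
  moreover have "poly_eval p (indicator S) = f S" if "S \<subseteq> A" for S
  proof -
    have "poly_eval p (indicator S) = (\<Sum>T\<in>Pow S. Poly_Mapping.lookup p (sqfree_monomial T))"
      using poly_eval_indicator[OF calculation assms that] .
    also have "\<dots> = (\<Sum>T\<in>Pow S. c T)"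
      using that by (intro sum.cong refl lookup_p) auto
    finally show ?thesis using c that by simp
  qed
  ultimately show ?thesis by blast
qed

lemma ex1_is_mle: "\<exists>!F. is_mle n f F"
proof (rule ex_ex1I)
  show "\<exists>F. is_mle n f F"
    using multilinear_exists[of "{1..n}" f] by (auto simp: is_mle_def poly_ring_def)
next
  fix F G assume "is_mle n f F" "is_mle n f G"
  then show "F = G"
    by (intro multilinear_eqI[of _ "{1..n}"]) (auto simp: is_mle_def poly_ring_def)
qed

lemma is_mle_mle: "is_mle n f (mle n f)"
  unfolding mle_def by (rule theI') (rule ex1_is_mle)

end

theory Submission
  imports Defs
begin

text \<open>
  At a vertex \<open>T\<close> of the cube, the polynomial \<open>-\<partial>\<^sub>i\<partial>\<^sub>jF\<close> takes the value
  \<open>f(T \<union> {i}) + f(T \<union> {j}) - f(T \<union> {i,j}) - f(T)\<close>. Submodularity is therefore nonnegativity of all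
  these polynomials on the cube, and a sum of squares modulo the vanishing ideal of the cube is a
  certificate of it. What has to be understood is which degrees \<open>t\<close> such certificates need.

  Lower bound. Some \<open>\<partial>\<^sub>i\<partial>\<^sub>jF\<close> has degree exactly \<open>d - 2\<close>: take \<open>i\<close> and \<open>j\<close> from a leading monomial. A sum
  of squares of polynomials of degree at most \<open>t\<close> has degree at most \<open>2t\<close>, and reducing it to
  multilinear form with \<open>x\<^sub>k\<^sup>2 \<mapsto> x\<^sub>k\<close> does not raise the degree. A multilinear polynomial is
  determined by its values on the cube, so \<open>d - 2 \<le> 2t\<close> (lemma \<open>sos_mod_degree\<close>).

  Upper bound. Let \<open>p\<close> be nonnegative on the cube \<open>2\<^sup>V\<close> and of degree at most \<open>e\<close>. The matrix
  \<open>M(S,S') = \<Sum>\<^sub>T p(T) \<chi>\<^sub>S(T) \<chi>\<^sub>S\<^sub>'(T)\<close>, where \<open>\<chi>\<^sub>S\<close> are the Walsh characters, is positive semidefinite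
  because \<open>p \<ge> 0\<close>. Its entries are Fourier coefficients of \<open>p\<close> at the symmetric difference of \<open>S\<close>
  and \<open>S'\<close>; they vanish when that set has more than \<open>e\<close> elements, in particular when the
  cardinalities of \<open>S\<close> and \<open>S'\<close> differ by more than \<open>e\<close>. So \<open>M\<close> is banded with respect to
  cardinality. Gaussian elimination preserves the band (\<open>banded_cholesky\<close>), and it writes \<open>M\<close>
  as a sum of rank-one matrices, each supported on sets with cardinalities in a window
  \<open>[k - e, k]\<close>. By orthogonality of the characters, \<open>p\<close> becomes a sum of squares of combinations
  of characters from one window each. If \<open>k \<le> t\<close>, such a combination has degree at most \<open>t\<close>.
  Otherwise, multiplying it by \<open>\<chi>\<^sub>V\<close> does not change its square, since \<open>\<chi>\<^sub>V\<^sup>2 = 1\<close>, and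
  replaces each \<open>S\<close> by \<open>V - S\<close>, whose cardinality is at most \<open>|V| + e - k \<le> t\<close> as soon as
  \<open>|V| + e \<le> 2t + 1\<close> (\<open>walsh_window_low_degree\<close>). The theorem is the case \<open>|V| = n - 2\<close> and
  \<open>e = d - 2\<close>.
\<close>

section \<open>Evaluation and degree\<close>

lemma carrier_poly_ring: "p \<in> carrier (poly_ring V) \<longleftrightarrow> vars p \<subseteq> V"
  by (simp add: poly_ring_def)

lemma finite_vars: "finite (vars p)"
  by (simp add: vars_def)

definition monomial_eval :: "monomial \<Rightarrow> (nat \<Rightarrow> real) \<Rightarrow> real" where
  "monomial_eval m x = (\<Prod>k\<in>Poly_Mapping.keys m. x k ^ Poly_Mapping.lookup m k)"

lemma monomial_eval_superset:
  assumes "finite K" "Poly_Mapping.keys m \<subseteq> K"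
  shows "monomial_eval m x = (\<Prod>k\<in>K. x k ^ Poly_Mapping.lookup m k)"
  unfolding monomial_eval_def using assms
  by (intro prod.mono_neutral_left) (auto simp: in_keys_iff)

lemma monomial_eval_add: "monomial_eval (m + m') x = monomial_eval m x * monomial_eval m' x"
proof -
  let ?K = "Poly_Mapping.keys m \<union> Poly_Mapping.keys m'"
  show ?thesis
    by (simp add: monomial_eval_superset[of ?K] keys_add_nat lookup_add power_add prod.distrib)
qed

lemma monomial_eval_indicator:
  "monomial_eval m (indicator T) = (if Poly_Mapping.keys m \<subseteq> T then 1 else 0)"
proof (cases "Poly_Mapping.keys m \<subseteq> T")
  case True
  then show ?thesis
    by (auto simp: monomial_eval_def indicator_def intro!: prod.neutral)
next
  case False
  then obtain k where "k \<in> Poly_Mapping.keys m" "k \<notin> T" by blast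
  then show ?thesis
    using False by (auto simp: monomial_eval_def in_keys_iff intro!: prod_zero bexI[of _ k])
qed

lemma poly_eval_superset:
  assumes "finite K" "Poly_Mapping.keys p \<subseteq> K"
  shows "poly_eval p x = (\<Sum>m\<in>K. Poly_Mapping.lookup p m * monomial_eval m x)"
  unfolding poly_eval_def monomial_eval_def[symmetric] using assms
  by (intro sum.mono_neutral_left) (auto simp: in_keys_iff)

lemma poly_eval_0 [simp]: "poly_eval 0 x = 0"
  by (simp add: poly_eval_def)

lemma poly_eval_single [simp]: "poly_eval (Poly_Mapping.single m c) x = c * monomial_eval m x"
  by (subst poly_eval_superset[of "{m}"]) auto

lemma poly_eval_1 [simp]: "poly_eval 1 x = 1"
  by (simp add: monomial_eval_def flip: single_one)

lemma poly_eval_Var [simp]: "poly_eval (Var k) x = x k"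
  by (simp add: Var_def monomial_eval_def)

lemma poly_eval_add [simp]: "poly_eval (p + q) x = poly_eval p x + poly_eval q x"
proof -
  let ?K = "Poly_Mapping.keys p \<union> Poly_Mapping.keys q"
  show ?thesis
    using Poly_Mapping.keys_add[of p q]
    by (simp add: poly_eval_superset[of ?K] lookup_add distrib_right sum.distrib)
qed

lemma poly_eval_uminus [simp]: "poly_eval (- p) x = - poly_eval p x"
  by (simp add: poly_eval_def sum_negf)

lemma poly_eval_diff [simp]: "poly_eval (p - q) x = poly_eval p x - poly_eval q x"
  using poly_eval_add[of p "- q" x] by simp

lemma poly_eval_sum [simp]: "poly_eval (\<Sum>i\<in>A. f i) x = (\<Sum>i\<in>A. poly_eval (f i) x)"
  by (induction A rule: infinite_finite_induct) auto

lemma poly_mapping_as_sum: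
  fixes p :: "'a \<Rightarrow>\<^sub>0 'b::comm_monoid_add"
  shows "(\<Sum>m\<in>Poly_Mapping.keys p. Poly_Mapping.single m (Poly_Mapping.lookup p m)) = p"
  by (rule poly_mapping_eqI) (simp add: lookup_sum lookup_single when_def in_keys_iff)

lemma poly_eval_mult [simp]: "poly_eval (p * q) x = poly_eval p x * poly_eval q x"
proof -
  have "p * q = (\<Sum>a\<in>Poly_Mapping.keys p. \<Sum>b\<in>Poly_Mapping.keys q.
      Poly_Mapping.single (a + b) (Poly_Mapping.lookup p a * Poly_Mapping.lookup q b))"
    by (subst (1) poly_mapping_as_sum[of p, symmetric], subst (1) poly_mapping_as_sum[of q, symmetric])
      (simp add: sum_product mult_single)
  then have "poly_eval (p * q) x = (\<Sum>a\<in>Poly_Mapping.keys p. \<Sum>b\<in>Poly_Mapping.keys q.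
      (Poly_Mapping.lookup p a * monomial_eval a x) * (Poly_Mapping.lookup q b * monomial_eval b x))"
    by (simp add: monomial_eval_add mult_ac)
  also have "\<dots> = poly_eval p x * poly_eval q x"
    by (simp add: poly_eval_superset[OF _ order_refl] sum_product)
  finally show ?thesis .
qed

lemma poly_eval_power [simp]: "poly_eval (p ^ k) x = poly_eval p x ^ k"
  by (induction k) auto

lemma poly_eval_prod [simp]: "poly_eval (\<Prod>i\<in>A. f i) x = (\<Prod>i\<in>A. poly_eval (f i) x)"
  by (induction A rule: infinite_finite_induct) auto

lemma poly_eval_at_indicator:
  "poly_eval p (indicator T) =
     (\<Sum>m\<in>Poly_Mapping.keys p. Poly_Mapping.lookup p m * (if Poly_Mapping.keys m \<subseteq> T then 1 else 0))"
  by (simp only: poly_eval_superset[OF finite_keys order_refl] monomial_eval_indicator)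

lemma monomial_degree_superset:
  assumes "finite K" "Poly_Mapping.keys m \<subseteq> K"
  shows "monomial_degree m = (\<Sum>k\<in>K. Poly_Mapping.lookup m k)"
  unfolding monomial_degree_def using assms
  by (intro sum.mono_neutral_left) (auto simp: in_keys_iff)

lemma monomial_degree_add: "monomial_degree (m + m') = monomial_degree m + monomial_degree m'"
proof -
  let ?K = "Poly_Mapping.keys m \<union> Poly_Mapping.keys m'"
  show ?thesis
    by (simp add: monomial_degree_superset[of ?K] keys_add_nat lookup_add sum.distrib)
qed

lemma monomial_degree_single [simp]: "monomial_degree (Poly_Mapping.single k c) = c"
  by (simp add: monomial_degree_superset[of "{k}"])

lemma monomial_degree_0 [simp]: "monomial_degree 0 = 0"
  by (simp add: monomial_degree_def)

lemma monomial_degree_sqfree: "finite S \<Longrightarrow> monomial_degree (sqfree_monomial S) = card S"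
  by (simp add: monomial_degree_def keys_sqfree_monomial lookup_sqfree_monomial)

lemma card_keys_le_monomial_degree: "card (Poly_Mapping.keys m) \<le> monomial_degree m"
proof -
  have "(\<Sum>k\<in>Poly_Mapping.keys m. 1) \<le> monomial_degree m"
    unfolding monomial_degree_def by (intro sum_mono) (auto simp: in_keys_iff)
  then show ?thesis by simp
qed

lemma total_degree_le_iff:
  "total_degree p \<le> d \<longleftrightarrow> (\<forall>m\<in>Poly_Mapping.keys p. monomial_degree m \<le> d)"
  by (simp add: total_degree_def)

lemma total_degree_add_le:
  "total_degree p \<le> d \<Longrightarrow> total_degree q \<le> d \<Longrightarrow> total_degree (p + q) \<le> d"
  using Poly_Mapping.keys_add[of p q] by (auto simp: total_degree_le_iff)

lemma total_degree_uminus [simp]: "total_degree (- p) = total_degree p"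
  by (simp add: total_degree_def)

lemma total_degree_0 [simp]: "total_degree 0 = 0"
  by (simp add: total_degree_def)

lemma total_degree_sum_le:
  assumes "\<And>i. i \<in> A \<Longrightarrow> total_degree (f i) \<le> d"
  shows "total_degree (\<Sum>i\<in>A. f i) \<le> d"
  using assms by (induction A rule: infinite_finite_induct) (auto intro: total_degree_add_le)

lemma total_degree_mult_le: "total_degree (p * q) \<le> total_degree p + total_degree q"
  unfolding total_degree_le_iff
proof
  fix m assume "m \<in> Poly_Mapping.keys (p * q)"
  then obtain a b where "m = a + b" "a \<in> Poly_Mapping.keys p" "b \<in> Poly_Mapping.keys q"
    using keys_mult[of p q] by blast
  then show "monomial_degree m \<le> total_degree p + total_degree q"
    by (auto simp: monomial_degree_add total_degree_le_iff[THEN iffD1, OF order_refl] intro!: add_mono)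
qed

lemma total_degree_prod_le:
  assumes "\<And>i. i \<in> A \<Longrightarrow> total_degree (f i) \<le> 1"
  shows "total_degree (\<Prod>i\<in>A. f i) \<le> card A"
  using assms
proof (induction A rule: infinite_finite_induct)
  case (insert i A)
  have "total_degree (\<Prod>i\<in>insert i A. f i) \<le> total_degree (f i) + total_degree (\<Prod>i\<in>A. f i)"
    using insert.hyps total_degree_mult_le by simp
  also have "\<dots> \<le> 1 + card A"
    using insert by (intro add_mono) auto
  finally show ?case using insert.hyps by simp
qed (auto simp: total_degree_def)

lemma total_degree_attained:
  assumes "0 < total_degree p"
  obtains m where "m \<in> Poly_Mapping.keys p" "monomial_degree m = total_degree p"
proof -
  have "total_degree p \<in> insert 0 (monomial_degree ` Poly_Mapping.keys p)"
    unfolding total_degree_def by (rule Max_in) auto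
  then show ?thesis using assms that by auto
qed

lemma vars_sum: "(\<And>i. i \<in> A \<Longrightarrow> vars (f i) \<subseteq> V) \<Longrightarrow> vars (\<Sum>i\<in>A. f i) \<subseteq> V"
  by (induction A rule: infinite_finite_induct) (simp_all add: vars_add)

lemma vars_prod: "(\<And>i. i \<in> A \<Longrightarrow> vars (f i) \<subseteq> V) \<Longrightarrow> vars (\<Prod>i\<in>A. f i) \<subseteq> V"
  by (induction A rule: infinite_finite_induct) (simp_all add: vars_mult)

lemma vars_diff: "vars p \<subseteq> V \<Longrightarrow> vars q \<subseteq> V \<Longrightarrow> vars (p - q) \<subseteq> V"
  using vars_add[of p V "- q"] by simp

lemma vars_power: "vars p \<subseteq> V \<Longrightarrow> vars (p ^ k) \<subseteq> V"
  by (induction k) (simp_all add: vars_mult)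

lemma vars_single_subset: "vars (Poly_Mapping.single m c) \<subseteq> Poly_Mapping.keys m"
  by (simp add: vars_def)


section \<open>The vanishing ideal of the cube\<close>

lemma vars_I2_generator: "k \<in> V \<Longrightarrow> vars (Var k ^ 2 - Var k) \<subseteq> V"
  by (intro vars_diff vars_power) auto

text \<open>The polynomials that vanish at a vertex form an ideal containing the generators, and
  \<^const>\<open>I2\<close> is the smallest such ideal.\<close>

lemma I2_vanishes:
  assumes "p \<in> I2 V"
  shows "poly_eval p (indicator T) = 0"
proof -
  interpret R: cring "poly_ring V" by (rule cring_poly_ring)
  let ?J = "{p. vars p \<subseteq> V \<and> poly_eval p (indicator T) = 0}"
  have "ideal ?J (poly_ring V)"
  proof (rule idealI)
    show "ring (poly_ring V)" by (rule R.ring_axioms)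
    have inv: "inv\<^bsub>add_monoid (poly_ring V)\<^esub> x = - x" if "vars x \<subseteq> V" for x
      unfolding a_inv_def[symmetric] using that
      by (intro R.minus_equality) (simp_all add: poly_ring_def)
    show "subgroup ?J (add_monoid (poly_ring V))"
    proof
      show "inv\<^bsub>add_monoid (poly_ring V)\<^esub> x \<in> ?J" if "x \<in> ?J" for x
        using that inv by simp
    qed (auto simp: poly_ring_def vars_add[THEN subsetD])
  qed (auto simp: poly_ring_def vars_mult[THEN subsetD])
  moreover have "{Var k ^ 2 - Var k | k. k \<in> V} \<subseteq> ?J"
    using vars_I2_generator by (fastforce simp: indicator_def)
  ultimately have "I2 V \<subseteq> ?J"
    unfolding I2_def by (rule R.genideal_minimal)
  then show ?thesis using assms by blast
qed

lemma I2_generator: "k \<in> V \<Longrightarrow> Var k ^ 2 - Var k \<in> I2 V"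
proof -
  assume k: "k \<in> V"
  interpret R: cring "poly_ring V" by (rule cring_poly_ring)
  have "{Var k ^ 2 - Var k | k. k \<in> V} \<subseteq> carrier (poly_ring V)"
    using vars_I2_generator unfolding carrier_poly_ring subset_iff by blast
  then show ?thesis
    unfolding I2_def using k by (intro subsetD[OF R.genideal_self]) auto
qed

lemma I2_add: "p \<in> I2 V \<Longrightarrow> q \<in> I2 V \<Longrightarrow> p + q \<in> I2 V"
  using additive_subgroup.a_closed[OF ideal.axioms(1)[OF ideal_I2]]
  by (simp add: poly_ring_def)

lemma I2_mult: "p \<in> I2 V \<Longrightarrow> vars q \<subseteq> V \<Longrightarrow> q * p \<in> I2 V"
  using ideal.I_l_closed[OF ideal_I2] by (simp add: poly_ring_def)

lemma I2_0: "0 \<in> I2 V"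
  using additive_subgroup.zero_closed[OF ideal.axioms(1)[OF ideal_I2[of V]]]
  by (simp add: poly_ring_def)

lemma I2_sum: "(\<And>i. i \<in> A \<Longrightarrow> f i \<in> I2 V) \<Longrightarrow> (\<Sum>i\<in>A. f i) \<in> I2 V"
  by (induction A rule: infinite_finite_induct) (auto intro: I2_0 I2_add)

text \<open>The normal form modulo \<^const>\<open>I2\<close>: every positive exponent is replaced by \<open>1\<close>.\<close>

definition multilinear_reduction :: "real_mpoly \<Rightarrow> real_mpoly" where
  "multilinear_reduction p = (\<Sum>m\<in>Poly_Mapping.keys p.
     Poly_Mapping.single (sqfree_monomial (Poly_Mapping.keys m)) (Poly_Mapping.lookup p m))"

lemma keys_multilinear_reduction:
  "Poly_Mapping.keys (multilinear_reduction p) \<subseteq>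
     (\<lambda>m. sqfree_monomial (Poly_Mapping.keys m)) ` Poly_Mapping.keys p"
  unfolding multilinear_reduction_def
  by (rule order_trans[OF Poly_Mapping.keys_sum]) auto

lemma multilinear_multilinear_reduction: "multilinear (multilinear_reduction p)"
  unfolding multilinear_def using keys_multilinear_reduction[of p]
  by (force simp: lookup_sqfree_monomial)

lemma vars_multilinear_reduction: "vars (multilinear_reduction p) \<subseteq> vars p"
  unfolding vars_def using keys_multilinear_reduction[of p]
  by (force simp: keys_sqfree_monomial)

lemma total_degree_multilinear_reduction:
  "total_degree (multilinear_reduction p) \<le> total_degree p"
  unfolding total_degree_le_iff
proof
  fix m assume "m \<in> Poly_Mapping.keys (multilinear_reduction p)"
  then obtain m' where m': "m' \<in> Poly_Mapping.keys p" "m = sqfree_monomial (Poly_Mapping.keys m')"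
    using keys_multilinear_reduction[of p] by blast
  then have "monomial_degree m \<le> monomial_degree m'"
    by (simp add: monomial_degree_sqfree card_keys_le_monomial_degree)
  also have "\<dots> \<le> total_degree p"
    using m'(1) total_degree_le_iff by blast
  finally show "monomial_degree m \<le> total_degree p" .
qed

text \<open>An exponent above \<open>1\<close> can be lowered by one without leaving the residue class, because
  \<open>r x\<^sub>k\<^sup>2 - r x\<^sub>k\<close> is a multiple of a generator. This keeps the variables of the monomial, so
  iterating it ends in the square-free monomial on the same variables.\<close>

lemma single_cong_I2:
  "Poly_Mapping.keys m \<subseteq> V \<Longrightarrow>
   Poly_Mapping.single m c - Poly_Mapping.single (sqfree_monomial (Poly_Mapping.keys m)) c \<in> I2 V"
proof (induction "monomial_degree m" arbitrary: m rule: less_induct)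
  case less
  show ?case
  proof (cases "\<forall>k. Poly_Mapping.lookup m k \<le> 1")
    case True
    then show ?thesis by (simp add: sqfree_monomial_keys I2_0)
  next
    case False
    then obtain k where k: "2 \<le> Poly_Mapping.lookup m k"
      by (metis not_less_eq_eq one_add_one plus_1_eq_Suc)
    define r where "r = m - Poly_Mapping.single k 2"
    define m' where "m' = r + Poly_Mapping.single k 1"
    have m: "m = r + Poly_Mapping.single k 2"
      unfolding r_def using k
      by (intro poly_mapping_eqI) (auto simp: lookup_add lookup_minus lookup_single when_def)
    have keys: "Poly_Mapping.keys m' = Poly_Mapping.keys m"
      by (simp add: m m'_def keys_add_nat)
    have "Poly_Mapping.single m c - Poly_Mapping.single m' c
        = Poly_Mapping.single r c * (Var k ^ 2 - Var k)"
      by (simp add: m m'_def Var_def power2_eq_square mult_single right_diff_distrib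
          numeral_2_eq_2 flip: single_add)
    also have "\<dots> \<in> I2 V"
      using less.prems vars_single_subset[of r c]
      by (intro I2_mult I2_generator) (auto simp: m keys_add_nat)
    finally have "Poly_Mapping.single m c - Poly_Mapping.single m' c \<in> I2 V" .
    moreover have "monomial_degree m' < monomial_degree m"
      by (simp add: m m'_def monomial_degree_add)
    then have "Poly_Mapping.single m' c
        - Poly_Mapping.single (sqfree_monomial (Poly_Mapping.keys m')) c \<in> I2 V"
      using less.prems by (intro less.hyps) (simp_all add: keys)
    ultimately show ?thesis
      using I2_add keys by fastforce
  qed
qed

lemma multilinear_reduction_cong:
  assumes "vars p \<subseteq> V"
  shows "p - multilinear_reduction p \<in> I2 V"
proof -
  have "p - multilinear_reduction p = (\<Sum>m\<in>Poly_Mapping.keys p.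
      Poly_Mapping.single m (Poly_Mapping.lookup p m)
      - Poly_Mapping.single (sqfree_monomial (Poly_Mapping.keys m)) (Poly_Mapping.lookup p m))"
    by (simp add: sum_subtractf poly_mapping_as_sum multilinear_reduction_def)
  also have "\<dots> \<in> I2 V"
    using assms by (intro I2_sum single_cong_I2) (auto simp: vars_def)
  finally show ?thesis .
qed

lemma poly_eval_multilinear_reduction:
  "poly_eval (multilinear_reduction p) (indicator T) = poly_eval p (indicator T)"
  using I2_vanishes[OF multilinear_reduction_cong[OF order_refl], of p T] by simp

text \<open>Two multilinear polynomials that agree on the cube are equal. This turns a congruence
  modulo \<^const>\<open>I2\<close> into an identity of polynomials, to which degrees can be applied.\<close>

lemma multilinear_reduction_eqI:
  assumes "multilinear p" "\<And>T. poly_eval p (indicator T) = poly_eval q (indicator T)"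
  shows "multilinear_reduction q = p"
  using assms vars_multilinear_reduction[of q]
  by (intro multilinear_eqI[of _ "vars p \<union> vars q"])
    (auto simp: multilinear_multilinear_reduction poly_eval_multilinear_reduction finite_vars)

text \<open>The converse of \<open>I2_vanishes\<close>: \<^const>\<open>I2\<close> is the full vanishing ideal of the cube. Hence a
  sum-of-squares certificate only has to be checked at the vertices.\<close>

lemma vanishing_in_I2:
  assumes "finite V" "vars p \<subseteq> V" "\<And>T. T \<subseteq> V \<Longrightarrow> poly_eval p (indicator T) = 0"
  shows "p \<in> I2 V"
proof -
  have "multilinear 0" by (simp add: multilinear_def)
  then have "multilinear_reduction p = 0"
    using assms vars_multilinear_reduction[of p]
    by (intro multilinear_eqI[of _ V])
      (auto simp: multilinear_multilinear_reduction poly_eval_multilinear_reduction)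
  then show ?thesis
    using multilinear_reduction_cong[OF assms(2)] by simp
qed

text \<open>The lower bound. Since \<open>p\<close> is the multilinear reduction of its certificate, and the reduction
  does not raise degrees, no cancellation can hide the degree of \<open>p\<close>.\<close>

lemma sos_mod_degree:
  assumes "multilinear p" "sos_mod V (I2 V) t p"
  shows "total_degree p \<le> 2 * t"
proof -
  obtain m :: nat and q where q: "\<And>r. r \<in> {1..m} \<Longrightarrow> total_degree (q r) \<le> t"
    and p: "p - (\<Sum>r=1..m. q r ^ 2) \<in> I2 V"
    using assms(2) unfolding sos_mod_def by blast
  let ?s = "\<Sum>r=1..m. q r ^ 2"
  have "multilinear_reduction ?s = p"
    using I2_vanishes[OF p] by (intro multilinear_reduction_eqI assms(1)) simp
  moreover have "total_degree ?s \<le> 2 * t"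
  proof (rule total_degree_sum_le)
    fix r assume "r \<in> {1..m}"
    then show "total_degree (q r ^ 2) \<le> 2 * t"
      using q[of r] total_degree_mult_le[of "q r" "q r"] by (simp add: power2_eq_square)
  qed
  ultimately show ?thesis
    using total_degree_multilinear_reduction[of ?s] by simp
qed

lemma sos_modI:
  assumes "finite V" "vars p \<subseteq> V" "finite A"
    and "\<And>c. c \<in> A \<Longrightarrow> vars (q c) \<subseteq> V \<and> total_degree (q c) \<le> t"
    and "\<And>T. T \<subseteq> V \<Longrightarrow> poly_eval p (indicator T) = (\<Sum>c\<in>A. poly_eval (q c) (indicator T) ^ 2)"
  shows "sos_mod V (I2 V) t p"
proof -
  obtain h where h: "bij_betw h {1..card A} A"
    using ex_bij_betw_nat_finite_1[OF \<open>finite A\<close>] by blast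
  then have hA: "h r \<in> A" if "r \<in> {1..card A}" for r
    using that bij_betwE by blast
  have "p - (\<Sum>r=1..card A. q (h r) ^ 2) \<in> I2 V"
  proof (rule vanishing_in_I2)
    show "vars (p - (\<Sum>r=1..card A. q (h r) ^ 2)) \<subseteq> V"
      using assms(2,4) hA by (intro vars_diff vars_sum vars_power) auto
  next
    fix T assume "T \<subseteq> V"
    moreover have "(\<Sum>r=1..card A. poly_eval (q (h r)) (indicator T) ^ 2)
        = (\<Sum>c\<in>A. poly_eval (q c) (indicator T) ^ 2)"
      by (rule sum.reindex_bij_betw[OF h])
    ultimately show "poly_eval (p - (\<Sum>r=1..card A. q (h r) ^ 2)) (indicator T) = 0"
      using assms(5) by simp
  qed (rule assms(1))
  then show ?thesis
    unfolding sos_mod_def carrier_poly_ring using assms(2,4) hA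
    by (intro conjI exI[of _ "card A"] exI[of _ "q \<circ> h"]) auto
qed


section \<open>Cholesky factors of banded matrices\<close>

text \<open>The quadratic form as a polynomial in the single coordinate \<open>x c\<close>, ready for completing the
  square.\<close>

lemma quadratic_form_insert:
  fixes M :: "'a \<Rightarrow> 'a \<Rightarrow> real"
  assumes "finite A" "c \<notin> A" "\<And>a. a \<in> A \<Longrightarrow> M a c = M c a"
  shows "(\<Sum>a\<in>insert c A. \<Sum>b\<in>insert c A. x a * x b * M a b) =
    x c ^ 2 * M c c + 2 * x c * (\<Sum>a\<in>A. x a * M c a) + (\<Sum>a\<in>A. \<Sum>b\<in>A. x a * x b * M a b)"
proof -
  have "(\<Sum>a\<in>A. x a * x c * M a c) = x c * (\<Sum>a\<in>A. x a * M c a)"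
    using assms(3) by (simp add: sum_distrib_left mult_ac)
  moreover have "(\<Sum>b\<in>A. x c * x b * M c b) = x c * (\<Sum>a\<in>A. x a * M c a)"
    by (simp add: sum_distrib_left mult_ac)
  ultimately show ?thesis
    using assms(1,2) by (simp add: sum.distrib power2_eq_square)
qed

text \<open>If the diagonal entry is zero, the form is affine in the coordinate \<open>c\<close>; a nonzero slope would
  make it negative somewhere. So there is nothing to eliminate in that row.\<close>

lemma psd_zero_diagonal:
  fixes M :: "'a \<Rightarrow> 'a \<Rightarrow> real"
  assumes "finite A" "c \<notin> A" "\<And>a. a \<in> A \<Longrightarrow> M a c = M c a"
    and psd: "\<And>x. 0 \<le> (\<Sum>a\<in>insert c A. \<Sum>b\<in>insert c A. x a * x b * M a b)"
    and "M c c = 0" "a \<in> A"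
  shows "M c a = 0"
proof (rule ccontr)
  assume ne: "M c a \<noteq> 0"
  \<comment> \<open>With a \<open>1\<close> at \<open>a\<close> the form is \<open>2 x\<^sub>c M\<^sub>c\<^sub>a + M\<^sub>a\<^sub>a\<close>; this \<open>x\<^sub>c\<close> makes it \<open>-1\<close>.\<close>
  define x where "x b = (if b = c then - (M a a + 1) / (2 * M c a) else if b = a then 1 else 0)" for b
  have xA: "x b = (if b = a then 1 else 0)" if "b \<in> A" for b
    using that assms(2) by (auto simp: x_def)
  have "(\<Sum>b\<in>A. x b * M c b) = (\<Sum>b\<in>A. if b = a then M c b else 0)"
    by (intro sum.cong refl) (simp add: xA)
  also have "\<dots> = M c a"
    using assms(1,6) by simp
  finally have lin: "(\<Sum>b\<in>A. x b * M c b) = M c a" .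
  have "(\<Sum>b\<in>A. \<Sum>b'\<in>A. x b * x b' * M b b')
      = (\<Sum>b\<in>A. \<Sum>b'\<in>A. if b' = a then (if b = a then M b b' else 0) else 0)"
    by (intro sum.cong refl) (simp add: xA)
  also have "\<dots> = M a a"
    using assms(1,6) by simp
  finally have "2 * x c * M c a + M a a \<ge> 0"
    using psd[of x] quadratic_form_insert[where M = M and x = x, OF assms(1-3)] lin assms(5) by simp
  moreover have "2 * x c * M c a = - (M a a + 1)"
    using ne by (simp add: x_def)
  ultimately show False by simp
qed

text \<open>Eliminating the indices in the order of decreasing weight causes no fill-in. When \<open>c\<close> is
  eliminated, the remaining indices weigh at most \<open>w c\<close>. Those that are coupled to \<open>c\<close> weigh at least
  \<open>w c - e\<close>, hence they differ pairwise by at most \<open>e\<close>, and the rank-one correction touches only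
  entries inside the band. The rank-one term of \<open>c\<close> is supported on these indices and \<open>c\<close>.\<close>

lemma banded_cholesky:
  fixes M :: "'a \<Rightarrow> 'a \<Rightarrow> real" and w :: "'a \<Rightarrow> nat"
  assumes "finite A"
    and "\<And>a b. a \<in> A \<Longrightarrow> b \<in> A \<Longrightarrow> M a b = M b a"
    and "\<And>x. 0 \<le> (\<Sum>a\<in>A. \<Sum>b\<in>A. x a * x b * M a b)"
    and "\<And>a b. a \<in> A \<Longrightarrow> b \<in> A \<Longrightarrow> w a + e < w b \<Longrightarrow> M a b = 0"
  obtains L where "\<And>a b. a \<in> A \<Longrightarrow> b \<in> A \<Longrightarrow> M a b = (\<Sum>c\<in>A. L c a * L c b)"
    and "\<And>c a. c \<in> A \<Longrightarrow> a \<in> A \<Longrightarrow> L c a \<noteq> 0 \<Longrightarrow> w a \<le> w c \<and> w c \<le> w a + e"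
proof -
  have "\<exists>L. (\<forall>a\<in>A. \<forall>b\<in>A. M a b = (\<Sum>c\<in>A. L c a * L c b)) \<and>
      (\<forall>c\<in>A. \<forall>a\<in>A. L c a \<noteq> 0 \<longrightarrow> w a \<le> w c \<and> w c \<le> w a + e)"
    using assms
  proof (induction A arbitrary: M rule: finite_ranking_induct[where f = w])
    case empty
    then show ?case by auto
  next
    case (insert c A)
    show ?case
    proof (cases "c \<in> A")
      case True
      then have "insert c A = A" by blast
      with insert show ?thesis by simp
    next
      case False
      note sym = insert.prems(1) and psd = insert.prems(2) and band = insert.prems(3)
      have sym_c: "M a c = M c a" if "a \<in> A" for a
        using sym that by simp
      have expand: "(\<Sum>a\<in>insert c A. \<Sum>b\<in>insert c A. x a * x b * M a b) =
          x c ^ 2 * M c c + 2 * x c * (\<Sum>a\<in>A. x a * M c a) + (\<Sum>a\<in>A. \<Sum>b\<in>A. x a * x b * M a b)"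
        for x
        by (rule quadratic_form_insert) (use insert.hyps(1) False sym_c in auto)
      have zero: "M c a = 0" if "M c c = 0" "a \<in> A" for a
        using psd_zero_diagonal[OF insert.hyps(1) False sym_c psd that] by simp
      have nonneg: "0 \<le> M c c"
      proof -
        have "(\<Sum>a\<in>A. (if a = c then 1 else 0) * M c a) = 0"
          using False by (intro sum.neutral) auto
        moreover have "(\<Sum>a\<in>A. \<Sum>b\<in>A. (if a = c then 1 else 0) * (if b = c then 1 else 0) * M a b) = 0"
          using False by (intro sum.neutral ballI) auto
        ultimately show ?thesis
          using psd[of "\<lambda>a. if a = c then 1 else 0"] expand[of "\<lambda>a. if a = c then 1 else 0"] by simp
      qed
      \<comment> \<open>The Schur complement. If \<open>M c c = 0\<close>, then \<open>x / 0 = 0\<close> makes the correction vanish; this is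
        right, because the whole row of \<open>c\<close> is zero.\<close>
      define M' where "M' a b = M a b - M c a * M c b / M c c" for a b
      have "\<exists>L. (\<forall>a\<in>A. \<forall>b\<in>A. M' a b = (\<Sum>c\<in>A. L c a * L c b)) \<and>
          (\<forall>c\<in>A. \<forall>a\<in>A. L c a \<noteq> 0 \<longrightarrow> w a \<le> w c \<and> w c \<le> w a + e)"
      proof (rule insert.IH)
        fix a b assume "a \<in> A" "b \<in> A"
        then show "M' a b = M' b a"
          using sym[of a b] by (simp add: M'_def)
      next
        fix x :: "'a \<Rightarrow> real"
        define s where "s = (\<Sum>a\<in>A. x a * M c a)"
        \<comment> \<open>The value at \<open>c\<close> minimises the form of \<open>M\<close> over the coordinate \<open>c\<close>; the minimum is the form
          of \<open>M'\<close>.\<close>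
        define y where "y = x(c := - s / M c c)"
        have yA: "y a = x a" if "a \<in> A" for a
          using that False by (auto simp: y_def)
        have "(\<Sum>a\<in>A. \<Sum>b\<in>A. x a * x b * M' a b)
            = (\<Sum>a\<in>A. \<Sum>b\<in>A. x a * x b * M a b)
              - (\<Sum>a\<in>A. \<Sum>b\<in>A. (x a * M c a) * (x b * M c b)) / M c c"
          by (simp add: M'_def right_diff_distrib sum_subtractf sum_divide_distrib mult_ac)
        also have "(\<Sum>a\<in>A. \<Sum>b\<in>A. (x a * M c a) * (x b * M c b)) = s * s"
          by (simp add: s_def sum_product)
        also have "(\<Sum>a\<in>A. \<Sum>b\<in>A. x a * x b * M a b) - s * s / M c c
            = y c ^ 2 * M c c + 2 * y c * (\<Sum>a\<in>A. y a * M c a) + (\<Sum>a\<in>A. \<Sum>b\<in>A. y a * y b * M a b)"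
        proof -
          have "(\<Sum>a\<in>A. y a * M c a) = s"
            by (simp add: s_def yA)
          moreover have "(\<Sum>a\<in>A. \<Sum>b\<in>A. y a * y b * M a b) = (\<Sum>a\<in>A. \<Sum>b\<in>A. x a * x b * M a b)"
            by (simp add: yA)
          moreover have "y c = - s / M c c"
            by (simp add: y_def)
          ultimately show ?thesis
            by (cases "M c c = 0") (simp_all add: power2_eq_square)
        qed
        also have "\<dots> \<ge> 0"
          using psd[of y] expand[of y] by simp
        finally show "0 \<le> (\<Sum>a\<in>A. \<Sum>b\<in>A. x a * x b * M' a b)" .
      next
        fix a b assume ab: "a \<in> A" "b \<in> A" "w a + e < w b"
        \<comment> \<open>The entry outside the band stays zero, because \<open>c\<close> is even farther from \<open>a\<close> than \<open>b\<close> is.\<close>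
        then have "w a + e < w c"
          using insert.hyps by fastforce
        then have "M a c = 0" using band ab(1) by blast
        then show "M' a b = 0"
          using band[of a b] ab sym_c[of a] by (simp add: M'_def)
      qed
      then obtain L where L: "\<And>a b. a \<in> A \<Longrightarrow> b \<in> A \<Longrightarrow> M' a b = (\<Sum>c\<in>A. L c a * L c b)"
        and band_L: "\<And>c a. c \<in> A \<Longrightarrow> a \<in> A \<Longrightarrow> L c a \<noteq> 0 \<Longrightarrow> w a \<le> w c \<and> w c \<le> w a + e"
        by blast
      define K where "K d a = (if d = c then M c a / sqrt (M c c) else if a = c then 0 else L d a)" for d a
      have col: "K c a * K c b = M c a * M c b / M c c" for a b
        using nonneg by (simp add: K_def)
      have "M a b = (\<Sum>d\<in>insert c A. K d a * K d b)" if ab: "a \<in> insert c A" "b \<in> insert c A" for a b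
      proof (cases "a = c \<or> b = c")
        case True
        then have "(\<Sum>d\<in>A. K d a * K d b) = 0"
          using False by (intro sum.neutral) (auto simp: K_def)
        moreover have "M a b = M c a * M c b / M c c"
        proof (cases "M c c = 0")
          case True
          then have "M c a = 0" "M c b = 0" using zero ab by blast+
          moreover have "M a b = M b a" using sym ab by blast
          ultimately show ?thesis using \<open>a = c \<or> b = c\<close> by auto
        next
          case False
          have "M a b = M b a" using sym ab by blast
          then show ?thesis using False True by auto
        qed
        ultimately show ?thesis
          using insert.hyps(1) False col by simp
      next
        case ne: False
        have "(\<Sum>d\<in>A. K d a * K d b) = (\<Sum>d\<in>A. L d a * L d b)"
          using False ne by (intro sum.cong refl) (auto simp: K_def)
        then show ?thesis
          using insert.hyps(1) False col ne ab L[of a b] by (simp add: M'_def)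
      qed
      moreover have "w a \<le> w d \<and> w d \<le> w a + e"
        if "d \<in> insert c A" "a \<in> insert c A" "K d a \<noteq> 0" for d a
      proof (cases "d = c")
        case True
        with that have "M a c \<noteq> 0"
          using sym[of a c] by (auto simp: K_def)
        then have "w c \<le> w a + e"
          using band[of a c] that(2) by fastforce
        then show ?thesis
          using True that(2) insert.hyps by auto
      next
        case False
        then show ?thesis
          using that band_L[of d a] by (auto simp: K_def split: if_splits)
      qed
      ultimately show ?thesis by blast
    qed
  qed
  then show ?thesis using that by blast
qed


section \<open>Walsh characters\<close>

text \<open>The character \<open>T \<mapsto> (-1)\<^bsup>|S \<inter> T|\<^esup>\<close> of the group \<open>(\<int>/2)\<^sup>V\<close>; the product form is the one in
  which it is a polynomial in the indicator of \<open>T\<close>.\<close>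

definition walsh :: "nat set \<Rightarrow> nat set \<Rightarrow> real" where
  "walsh S T = (\<Prod>k\<in>S. 1 - 2 * indicator T k)"

lemma walsh_superset:
  assumes "finite V" "S \<subseteq> V"
  shows "walsh S T = (\<Prod>k\<in>V. if k \<in> S \<inter> T then - 1 else 1)"
proof -
  have "walsh S T = (\<Prod>k\<in>S. if k \<in> S \<inter> T then - 1 else 1)"
    unfolding walsh_def by (intro prod.cong) auto
  also have "\<dots> = (\<Prod>k\<in>V. if k \<in> S \<inter> T then - 1 else 1)"
    using assms by (intro prod.mono_neutral_left) auto
  finally show ?thesis .
qed

lemma walsh_commute:
  assumes "finite S" "finite T"
  shows "walsh S T = walsh T S"
proof -
  have "S \<subseteq> S \<union> T" "T \<subseteq> S \<union> T" by auto
  then show ?thesis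
    using assms by (simp add: walsh_superset[of "S \<union> T"] conj_commute)
qed

lemma walsh_mult:
  assumes "finite S" "finite S'"
  shows "walsh S T * walsh S' T = walsh (sym_diff S S') T"
proof -
  let ?V = "S \<union> S'"
  have "sym_diff S S' \<subseteq> ?V" by auto
  then show ?thesis
    using assms unfolding walsh_superset[of ?V, OF _ Un_upper1] walsh_superset[of ?V, OF _ Un_upper2]
    by (subst walsh_superset[of ?V]) (auto simp: walsh_superset[of ?V] prod.distrib[symmetric] intro!: prod.cong)
qed

lemma walsh_square: "walsh S T ^ 2 = 1"
  unfolding walsh_def prod_power_distrib
  by (intro prod.neutral) (auto simp: indicator_def)

lemma walsh_flip:
  assumes "finite W" "w \<in> W"
  shows "walsh W (sym_diff T {w}) = - walsh W T"
proof -
  have "(\<Prod>k\<in>W - {w}. 1 - 2 * indicator (sym_diff T {w}) k) = (\<Prod>k\<in>W - {w}. 1 - 2 * indicator T k :: real)"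
    by (intro prod.cong) (auto simp: indicator_def)
  then show ?thesis
    unfolding walsh_def prod.remove[OF assms] by (auto simp: indicator_def)
qed

text \<open>Toggling \<open>w\<close> in \<open>T\<close> permutes the subsets of \<open>V\<close> and flips the sign of every summand.\<close>

lemma sum_walsh_zero:
  assumes "finite V" "W \<subseteq> V" "w \<in> W" and inv: "\<And>T. T \<subseteq> V \<Longrightarrow> c (sym_diff T {w}) = c T"
  shows "(\<Sum>T\<in>Pow V. c T * walsh W T) = 0"
proof -
  have "finite W" using assms finite_subset by blast
  then have "(\<Sum>T\<in>Pow V. c T * walsh W T) = (\<Sum>T\<in>Pow V. - (c T * walsh W T))"
    using assms
    by (intro sum.reindex_bij_witness[of _ "\<lambda>T. sym_diff T {w}" "\<lambda>T. sym_diff T {w}"])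
      (auto simp del: Un_insert_right simp: walsh_flip)
  then show ?thesis by (simp add: sum_negf)
qed

lemma walsh_orthogonal:
  assumes "finite V" "T \<subseteq> V" "T' \<subseteq> V"
  shows "(\<Sum>S\<in>Pow V. walsh S T * walsh S T') = (if T = T' then 2 ^ card V else 0)"
proof -
  have fin: "finite S" if "S \<subseteq> V" for S
    using that assms(1) finite_subset by blast
  have "(\<Sum>S\<in>Pow V. walsh S T * walsh S T') = (\<Sum>S\<in>Pow V. 1 * walsh (sym_diff T T') S)"
    using assms(2,3) fin by (intro sum.cong refl) (auto simp: walsh_mult walsh_commute[of _ T] walsh_commute[of _ T'])
  also have "\<dots> = (if T = T' then 2 ^ card V else 0)"
  proof (cases "T = T'")
    case True
    then show ?thesis using assms(1) by (simp add: walsh_def card_Pow)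
  next
    case False
    then obtain w where "w \<in> sym_diff T T'" by blast
    moreover have "sym_diff T T' \<subseteq> V" using assms by blast
    ultimately have "(\<Sum>S\<in>Pow V. 1 * walsh (sym_diff T T') S) = 0"
      using assms(1) by (intro sum_walsh_zero) auto
    with False show ?thesis by simp
  qed
  finally show ?thesis .
qed

text \<open>A monomial with fewer variables than \<open>W\<close> has elements misses some \<open>w \<in> W\<close>, so its values on the
  cube are invariant under toggling \<open>w\<close>.\<close>

lemma low_degree_orthogonal_walsh:
  assumes "finite V" "W \<subseteq> V" "total_degree p < card W"
  shows "(\<Sum>T\<in>Pow V. poly_eval p (indicator T) * walsh W T) = 0"
proof -
  have "(\<Sum>T\<in>Pow V. (if Poly_Mapping.keys m \<subseteq> T then 1 else 0) * walsh W T) = 0"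
    if "m \<in> Poly_Mapping.keys p" for m
  proof -
    have "card (Poly_Mapping.keys m) \<le> total_degree p"
      using that total_degree_le_iff[of p "total_degree p"] card_keys_le_monomial_degree[of m] by fastforce
    then have "\<not> W \<subseteq> Poly_Mapping.keys m"
      using assms(3) card_mono[of "Poly_Mapping.keys m" W] by auto
    then obtain w where "w \<in> W" "w \<notin> Poly_Mapping.keys m" by blast
    then show ?thesis
      using assms(1,2) by (intro sum_walsh_zero[of V W w]) auto
  qed
  then have "(\<Sum>m\<in>Poly_Mapping.keys p. Poly_Mapping.lookup p m *
      (\<Sum>T\<in>Pow V. (if Poly_Mapping.keys m \<subseteq> T then 1 else 0) * walsh W T)) = 0"
    by simp
  then show ?thesis
    unfolding poly_eval_at_indicator sum_distrib_left sum_distrib_right mult.assoc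
    by (subst sum.swap)
qed

definition walsh_poly :: "nat set \<Rightarrow> real_mpoly" where
  "walsh_poly S = (\<Prod>k\<in>S. 1 - 2 * Var k)"

lemma poly_eval_walsh_poly: "poly_eval (walsh_poly S) (indicator T) = walsh S T"
proof -
  have "poly_eval 2 x = 2" for x
    using poly_eval_add[of 1 1 x] by (simp only: one_add_one poly_eval_1)
  then show ?thesis by (simp add: walsh_poly_def walsh_def)
qed

lemma vars_walsh_poly: "vars (walsh_poly S) \<subseteq> S"
  unfolding walsh_poly_def mult_2 by (intro vars_prod vars_diff vars_add) auto

lemma total_degree_walsh_poly: "total_degree (walsh_poly S) \<le> card S"
  unfolding walsh_poly_def
proof (rule total_degree_prod_le)
  fix k
  have "total_degree (Var k) \<le> 1" "total_degree 1 \<le> 1"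
    by (simp_all add: total_degree_le_iff Var_def)
  then have "total_degree (1 + (- (Var k + Var k))) \<le> 1"
    by (simp only: total_degree_uminus total_degree_add_le)
  then show "total_degree (1 - 2 * Var k) \<le> 1"
    unfolding mult_2 by (simp only: add_uminus_conv_diff)
qed

section \<open>Nonnegative polynomials on the cube\<close>

lemma walsh_combination_low_degree:
  assumes "finite V" "\<And>S. S \<subseteq> V \<Longrightarrow> x S \<noteq> 0 \<Longrightarrow> card S \<le> t"
  obtains q where "vars q \<subseteq> V" "total_degree q \<le> t"
    "\<And>T. poly_eval q (indicator T) = (\<Sum>S\<in>Pow V. x S * walsh S T)"
proof
  let ?q = "\<Sum>S\<in>Pow V. Poly_Mapping.single 0 (x S) * walsh_poly S"
  show "vars ?q \<subseteq> V"
    using vars_walsh_poly vars_single_subset[of 0]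
    by (intro vars_sum vars_mult) fastforce+
  show "total_degree ?q \<le> t"
  proof (rule total_degree_sum_le)
    fix S assume S: "S \<in> Pow V"
    show "total_degree (Poly_Mapping.single 0 (x S) * walsh_poly S) \<le> t"
    proof (cases "x S = 0")
      case False
      have "total_degree (Poly_Mapping.single 0 (x S)) = 0"
        by (simp add: total_degree_def)
      then show ?thesis
        using False S assms(2)[of S] total_degree_walsh_poly[of S]
          total_degree_mult_le[of "Poly_Mapping.single 0 (x S)" "walsh_poly S"] by simp
    qed simp
  qed
  show "poly_eval ?q (indicator T) = (\<Sum>S\<in>Pow V. x S * walsh S T)" for T
    by (simp add: poly_eval_walsh_poly monomial_eval_def)
qed

text \<open>Either the window \<open>[k - e, k]\<close> lies below \<open>t\<close>, or the reflected window \<open>[|V| - k, |V| - k + e]\<close>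
  does. The reflection is multiplication by the character of \<open>V\<close>, whose values are \<open>\<plusminus>1\<close>; so
  the square keeps its values, although the combination itself does not.\<close>

lemma walsh_window_low_degree:
  assumes "finite V" "\<And>S. S \<subseteq> V \<Longrightarrow> x S \<noteq> 0 \<Longrightarrow> card S \<le> k \<and> k \<le> card S + e"
    and "card V + e \<le> 2 * t + 1"
  obtains q where "vars q \<subseteq> V" "total_degree q \<le> t"
    "\<And>T. poly_eval q (indicator T) ^ 2 = (\<Sum>S\<in>Pow V. x S * walsh S T) ^ 2"
proof (cases "k \<le> t")
  case True
  then have "card S \<le> t" if "S \<subseteq> V" "x S \<noteq> 0" for S
    using assms(2)[OF that] by simp
  then obtain q where "vars q \<subseteq> V" "total_degree q \<le> t"
    "\<And>T. poly_eval q (indicator T) = (\<Sum>S\<in>Pow V. x S * walsh S T)"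
    using walsh_combination_low_degree[of V x t] assms(1) by blast
  then show ?thesis using that by simp
next
  case False
  have "card S \<le> t" if "S \<subseteq> V" "x (V - S) \<noteq> 0" for S
  proof -
    have "k \<le> card (V - S) + e" using assms(2)[of "V - S"] that by blast
    moreover have "card (V - S) + card S = card V"
      using that(1) assms(1) card_mono[of V S] by (simp add: card_Diff_subset finite_subset)
    ultimately show ?thesis using False assms(3) by simp
  qed
  then obtain q where q: "vars q \<subseteq> V" "total_degree q \<le> t"
    "\<And>T. poly_eval q (indicator T) = (\<Sum>S\<in>Pow V. x (V - S) * walsh S T)"
    using walsh_combination_low_degree[of V "\<lambda>S. x (V - S)" t] assms(1) by blast
  have "poly_eval q (indicator T) = walsh V T * (\<Sum>S\<in>Pow V. x S * walsh S T)" for T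
  proof -
    have "walsh V T * walsh S T = walsh (V - S) T" if "S \<subseteq> V" for S
      using that assms(1) walsh_mult[of V S T] finite_subset[of S V]
      by (metis Diff_eq_empty_iff Un_empty_right)
    then have "walsh V T * (\<Sum>S\<in>Pow V. x S * walsh S T) = (\<Sum>S\<in>Pow V. x S * walsh (V - S) T)"
      unfolding sum_distrib_left by (intro sum.cong refl) (simp add: mult.left_commute)
    also have "\<dots> = (\<Sum>S\<in>Pow V. x (V - S) * walsh S T)"
      by (intro sum.reindex_bij_witness[of _ "\<lambda>S. V - S" "\<lambda>S. V - S"]) (auto simp: double_diff)
    finally show ?thesis using q(3) by simp
  qed
  then have "poly_eval q (indicator T) ^ 2 = (\<Sum>S\<in>Pow V. x S * walsh S T) ^ 2" for T
    by (simp add: power_mult_distrib walsh_square)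
  then show ?thesis using that q by blast
qed

text \<open>The upper bound. Writing \<open>\<chi>\<^sub>S\<close> for \<^term>\<open>walsh S\<close> and \<open>N = 2\<^bsup>|V|\<^esup>\<close>, orthogonality gives
  \<open>\<Sum>\<^sub>S\<^sub>,\<^sub>S\<^sub>' M(S,S') \<chi>\<^sub>S(U) \<chi>\<^sub>S\<^sub>'(U) = N\<^sup>2 p(U)\<close>, and a banded Cholesky factorisation of \<open>M\<close> makes the
  left-hand side a sum of squares of combinations over windows.\<close>

theorem nonneg_on_cube_sos_mod:
  assumes "finite V" "vars p \<subseteq> V" "total_degree p \<le> e"
    and nonneg: "\<And>T. T \<subseteq> V \<Longrightarrow> 0 \<le> poly_eval p (indicator T)"
    and "card V + e \<le> 2 * t + 1"
  shows "sos_mod V (I2 V) t p"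
proof -
  let ?g = "\<lambda>T. poly_eval p (indicator T)"
  define N where "N = (2::real) ^ card V"
  define M where "M S S' = (\<Sum>T\<in>Pow V. ?g T * (walsh S T * walsh S' T))" for S S'
  have fin: "finite S" if "S \<subseteq> V" for S
    using that assms(1) finite_subset by blast
  have form: "(\<Sum>S\<in>Pow V. \<Sum>S'\<in>Pow V. x S * x S' * M S S')
      = (\<Sum>T\<in>Pow V. ?g T * (\<Sum>S\<in>Pow V. x S * walsh S T) ^ 2)" for x
  proof -
    have "(\<Sum>S\<in>Pow V. \<Sum>S'\<in>Pow V. x S * x S' * M S S')
        = (\<Sum>S\<in>Pow V. \<Sum>S'\<in>Pow V. \<Sum>T\<in>Pow V. ?g T * ((x S * walsh S T) * (x S' * walsh S' T)))"
      by (simp add: M_def sum_distrib_left mult_ac)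
    also have "\<dots> = (\<Sum>S\<in>Pow V. \<Sum>T\<in>Pow V. \<Sum>S'\<in>Pow V. ?g T * ((x S * walsh S T) * (x S' * walsh S' T)))"
      by (intro sum.cong refl sum.swap)
    also have "\<dots> = (\<Sum>T\<in>Pow V. \<Sum>S\<in>Pow V. \<Sum>S'\<in>Pow V. ?g T * ((x S * walsh S T) * (x S' * walsh S' T)))"
      by (rule sum.swap)
    also have "\<dots> = (\<Sum>T\<in>Pow V. ?g T * (\<Sum>S\<in>Pow V. x S * walsh S T) ^ 2)"
      unfolding power2_eq_square sum_product by (simp add: sum_distrib_left)
    finally show ?thesis .
  qed
  have "\<exists>L. (\<forall>S\<in>Pow V. \<forall>S'\<in>Pow V. M S S' = (\<Sum>C\<in>Pow V. L C S * L C S')) \<and>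
     (\<forall>C\<in>Pow V. \<forall>S\<in>Pow V. L C S \<noteq> 0 \<longrightarrow> card S \<le> card C \<and> card C \<le> card S + e)"
  proof (rule banded_cholesky[of "Pow V" M card e])
    show "finite (Pow V)" using assms(1) by simp
    show "M S S' = M S' S" for S S' by (simp add: M_def mult.commute)
    show "0 \<le> (\<Sum>S\<in>Pow V. \<Sum>S'\<in>Pow V. x S * x S' * M S S')" for x
      unfolding form using nonneg by (intro sum_nonneg) auto
  next
    fix S S' assume S: "S \<in> Pow V" "S' \<in> Pow V" "card S + e < card S'"
    \<comment> \<open>Sets whose cardinalities differ by more than \<open>e\<close> have a symmetric difference with more than
      \<open>e\<close> elements, and \<open>p\<close> has no Fourier coefficient there.\<close>
    have "card S' \<le> card (S \<union> sym_diff S S')"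
      using S fin by (intro card_mono) auto
    also have "\<dots> \<le> card S + card (sym_diff S S')"
      by (rule card_Un_le)
    finally have "total_degree p < card (sym_diff S S')"
      using S(3) assms(3) by simp
    then have "(\<Sum>T\<in>Pow V. ?g T * walsh (sym_diff S S') T) = 0"
      using S by (intro low_degree_orthogonal_walsh assms(1)) auto
    then show "M S S' = 0"
      using S fin by (simp add: M_def walsh_mult)
  qed blast
  then obtain L where L: "\<And>S S'. S \<in> Pow V \<Longrightarrow> S' \<in> Pow V \<Longrightarrow> M S S' = (\<Sum>C\<in>Pow V. L C S * L C S')"
    and window: "\<And>C S. C \<in> Pow V \<Longrightarrow> S \<in> Pow V \<Longrightarrow> L C S \<noteq> 0 \<Longrightarrow> card S \<le> card C \<and> card C \<le> card S + e"
    by blast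
  have "\<exists>q. vars q \<subseteq> V \<and> total_degree q \<le> t \<and>
      (\<forall>T. poly_eval q (indicator T) ^ 2 = (\<Sum>S\<in>Pow V. L C S / N * walsh S T) ^ 2)"
    if "C \<in> Pow V" for C
    by (rule walsh_window_low_degree[of V "\<lambda>S. L C S / N" "card C" e t])
      (use that window[OF that] assms(1,5) in auto)
  then obtain q where q: "\<And>C. C \<in> Pow V \<Longrightarrow> vars (q C) \<subseteq> V \<and> total_degree (q C) \<le> t"
    and qsq: "\<And>C T. C \<in> Pow V \<Longrightarrow>
      poly_eval (q C) (indicator T) ^ 2 = (\<Sum>S\<in>Pow V. L C S / N * walsh S T) ^ 2"
    by metis
  show ?thesis
  proof (rule sos_modI[OF assms(1,2) _ q])
    show "finite (Pow V)" using assms(1) by simp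
  next
    fix U assume U: "U \<subseteq> V"
    have "(\<Sum>S\<in>Pow V. \<Sum>S'\<in>Pow V. walsh S U * walsh S' U * M S S')
        = (\<Sum>T\<in>Pow V. ?g T * (\<Sum>S\<in>Pow V. walsh S U * walsh S T) ^ 2)"
      by (rule form)
    also have "\<dots> = (\<Sum>T\<in>Pow V. if T = U then ?g T * N ^ 2 else 0)"
      using U assms(1) by (intro sum.cong refl) (auto simp: walsh_orthogonal N_def)
    also have "\<dots> = ?g U * N ^ 2"
      using U assms(1) by simp
    finally have gU: "?g U = (\<Sum>S\<in>Pow V. \<Sum>S'\<in>Pow V. walsh S U * walsh S' U * M S S') / N ^ 2"
      by (simp add: N_def)
    have "(\<Sum>S\<in>Pow V. \<Sum>S'\<in>Pow V. walsh S U * walsh S' U * M S S')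
        = (\<Sum>S\<in>Pow V. \<Sum>S'\<in>Pow V. \<Sum>C\<in>Pow V. (L C S * walsh S U) * (L C S' * walsh S' U))"
      by (intro sum.cong refl) (simp add: L sum_distrib_left mult_ac)
    also have "\<dots> = (\<Sum>S\<in>Pow V. \<Sum>C\<in>Pow V. \<Sum>S'\<in>Pow V. (L C S * walsh S U) * (L C S' * walsh S' U))"
      by (intro sum.cong refl sum.swap)
    also have "\<dots> = (\<Sum>C\<in>Pow V. \<Sum>S\<in>Pow V. \<Sum>S'\<in>Pow V. (L C S * walsh S U) * (L C S' * walsh S' U))"
      by (rule sum.swap)
    also have "\<dots> = (\<Sum>C\<in>Pow V. (\<Sum>S\<in>Pow V. L C S * walsh S U) ^ 2)"
      by (simp add: power2_eq_square sum_product)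
    finally have "?g U = (\<Sum>C\<in>Pow V. (\<Sum>S\<in>Pow V. L C S * walsh S U) ^ 2) / N ^ 2"
      using gU by simp
    also have "\<dots> = (\<Sum>C\<in>Pow V. (\<Sum>S\<in>Pow V. L C S / N * walsh S U) ^ 2)"
      by (simp add: sum_divide_distrib[symmetric] power_divide)
    also have "\<dots> = (\<Sum>C\<in>Pow V. poly_eval (q C) (indicator U) ^ 2)"
      by (simp add: qsq)
    finally show "?g U = (\<Sum>C\<in>Pow V. poly_eval (q C) (indicator U) ^ 2)" .
  qed
qed


section \<open>Second derivatives of the multilinear extension\<close>

lemma lookup_partial_deriv:
  "Poly_Mapping.lookup (partial_deriv i p) m =
     real (Poly_Mapping.lookup m i + 1) * Poly_Mapping.lookup p (m + Poly_Mapping.single i 1)"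
proof -
  let ?s = "Poly_Mapping.single i (1::nat)"
  have "(real (Poly_Mapping.lookup m' i) * Poly_Mapping.lookup p m' when m' - ?s = m)
      = (if m' = m + ?s then real (Poly_Mapping.lookup m i + 1) * Poly_Mapping.lookup p (m + ?s) else 0)" for m'
  proof (cases "Poly_Mapping.lookup m' i = 0")
    case True
    then have "m' \<noteq> m + ?s" by (auto simp: lookup_add)
    with True show ?thesis by simp
  next
    case False
    then have "m' = (m' - ?s) + ?s"
      by (intro poly_mapping_eqI) (auto simp: lookup_add lookup_minus lookup_single when_def)
    moreover have "(m + ?s) - ?s = m" by simp
    ultimately have "m' - ?s = m \<longleftrightarrow> m' = m + ?s" by metis
    then show ?thesis by (auto simp: when_def lookup_add)
  qed
  then show ?thesis
    unfolding partial_deriv_def lookup_sum lookup_single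
    by (simp add: in_keys_iff)
qed

lemma keys_partial_deriv:
  "Poly_Mapping.keys (partial_deriv i p) = {m. m + Poly_Mapping.single i 1 \<in> Poly_Mapping.keys p}"
  by (auto simp: in_keys_iff lookup_partial_deriv)

lemma multilinear_partial_deriv:
  assumes "multilinear p"
  shows "multilinear (partial_deriv i p)"
  unfolding multilinear_def keys_partial_deriv
proof safe
  fix m k assume "m + Poly_Mapping.single i 1 \<in> Poly_Mapping.keys p"
  then have "Poly_Mapping.lookup (m + Poly_Mapping.single i 1) k \<le> 1"
    using assms by (auto simp: multilinear_def)
  then show "Poly_Mapping.lookup m k \<le> 1" by (simp add: lookup_add)
qed

lemma vars_partial_deriv:
  assumes "multilinear p"
  shows "vars (partial_deriv i p) \<subseteq> vars p - {i}"
proof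
  fix k assume "k \<in> vars (partial_deriv i p)"
  then obtain m where m: "m + Poly_Mapping.single i 1 \<in> Poly_Mapping.keys p" "k \<in> Poly_Mapping.keys m"
    by (auto simp: vars_def keys_partial_deriv)
  have "Poly_Mapping.lookup (m + Poly_Mapping.single i 1) i \<le> 1"
    using assms m(1) by (auto simp: multilinear_def)
  then have "k \<noteq> i" using m(2) by (auto simp: lookup_add in_keys_iff)
  moreover have "k \<in> vars p"
    using m by (auto simp: vars_def keys_add_nat intro!: bexI[of _ "m + Poly_Mapping.single i 1"])
  ultimately show "k \<in> vars p - {i}" by blast
qed

text \<open>A multilinear polynomial is affine in \<open>x\<^sub>i\<close>, so its derivative is a difference.\<close>

lemma poly_eval_partial_deriv:
  assumes "multilinear p" "finite T" "i \<notin> T"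
  shows "poly_eval (partial_deriv i p) (indicator T)
    = poly_eval p (indicator (insert i T)) - poly_eval p (indicator T)"
proof -
  let ?A = "vars p \<union> insert i T"
  have fin: "finite ?A" using assms(2) finite_vars by simp
  note ev = poly_eval_indicator[of _ ?A, OF _ _ fin]
  have inj: "inj_on (insert i) (Pow T)"
    using assms(3) by (auto simp: inj_on_def)
  have "poly_eval p (indicator (insert i T))
      = (\<Sum>S\<in>Pow T. Poly_Mapping.lookup p (sqfree_monomial S))
        + (\<Sum>S\<in>insert i ` Pow T. Poly_Mapping.lookup p (sqfree_monomial S))"
    unfolding ev[OF assms(1) Un_upper1 Un_upper2] Pow_insert
    using assms(2,3) by (intro sum.union_disjoint) auto
  also have "(\<Sum>S\<in>Pow T. Poly_Mapping.lookup p (sqfree_monomial S)) = poly_eval p (indicator T)"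
    by (rule ev[symmetric]) (use assms(1) in auto)
  also have "(\<Sum>S\<in>insert i ` Pow T. Poly_Mapping.lookup p (sqfree_monomial S))
      = (\<Sum>S\<in>Pow T. Poly_Mapping.lookup (partial_deriv i p) (sqfree_monomial S))"
    unfolding sum.reindex[OF inj]
  proof (intro sum.cong refl)
    fix S assume "S \<in> Pow T"
    then have "i \<notin> S" "finite S" using assms finite_subset by auto
    then show "((\<lambda>S. Poly_Mapping.lookup p (sqfree_monomial S)) \<circ> insert i) S
        = Poly_Mapping.lookup (partial_deriv i p) (sqfree_monomial S)"
      by (simp add: lookup_partial_deriv lookup_sqfree_monomial)
        (simp add: sqfree_monomial_def add.commute)
  qed
  also have "\<dots> = poly_eval (partial_deriv i p) (indicator T)"
    by (rule ev[symmetric])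
      (use assms(1) vars_partial_deriv[of p i] multilinear_partial_deriv in auto)
  finally show ?thesis by simp
qed

lemma total_degree_second_deriv:
  "total_degree (partial_deriv i (partial_deriv j p)) \<le> total_degree p - 2"
  unfolding total_degree_le_iff keys_partial_deriv
proof safe
  fix m assume "m + Poly_Mapping.single i 1 + Poly_Mapping.single j 1 \<in> Poly_Mapping.keys p"
  then have "monomial_degree (m + Poly_Mapping.single i 1 + Poly_Mapping.single j 1) \<le> total_degree p"
    using total_degree_le_iff by blast
  then show "monomial_degree m \<le> total_degree p - 2"
    by (simp add: monomial_degree_add)
qed

lemma second_deriv_zero:
  assumes "total_degree p < 2"
  shows "partial_deriv i (partial_deriv j p) = 0"
proof -
  have "m + Poly_Mapping.single i 1 + Poly_Mapping.single j 1 \<notin> Poly_Mapping.keys p" for m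
    using assms total_degree_le_iff[of p "total_degree p"]
    by (fastforce simp: monomial_degree_add)
  then have "Poly_Mapping.keys (partial_deriv i (partial_deriv j p)) = {}"
    by (auto simp: keys_partial_deriv)
  then show ?thesis by simp
qed

text \<open>Differentiation in two variables of a leading monomial lowers its degree by \<open>2\<close>, and distinct
  monomials keep distinct images, so nothing cancels.\<close>

lemma second_deriv_degree_attained:
  assumes "multilinear p" "2 \<le> total_degree p"
  obtains i j where "i \<in> vars p" "j \<in> vars p" "i \<noteq> j"
    "total_degree (partial_deriv i (partial_deriv j p)) = total_degree p - 2"
proof -
  obtain m where m: "m \<in> Poly_Mapping.keys p" "monomial_degree m = total_degree p"
    using total_degree_attained[of p] assms(2) by auto
  have m_sq: "m = sqfree_monomial (Poly_Mapping.keys m)"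
    using assms(1) m(1) by (intro sqfree_monomial_keys[symmetric]) (auto simp: multilinear_def)
  then have "2 \<le> card (Poly_Mapping.keys m)"
    using assms(2) m(2) by (metis finite_keys monomial_degree_sqfree)
  then obtain i j where ij: "i \<in> Poly_Mapping.keys m" "j \<in> Poly_Mapping.keys m" "i \<noteq> j"
    by (meson card_2_iff' obtain_subset_with_card_n subsetD)
  define r where "r = m - Poly_Mapping.single i 1 - Poly_Mapping.single j 1"
  have r: "r + Poly_Mapping.single i 1 + Poly_Mapping.single j 1 = m"
    unfolding r_def using ij
    by (intro poly_mapping_eqI) (auto simp: lookup_add lookup_minus lookup_single when_def in_keys_iff)
  have "r \<in> Poly_Mapping.keys (partial_deriv i (partial_deriv j p))"
    using m(1) r by (simp add: keys_partial_deriv)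
  then have "monomial_degree r \<le> total_degree (partial_deriv i (partial_deriv j p))"
    using total_degree_le_iff by blast
  moreover have "monomial_degree r = total_degree p - 2"
    using m(2) unfolding r[symmetric] by (simp add: monomial_degree_add)
  ultimately have "total_degree (partial_deriv i (partial_deriv j p)) = total_degree p - 2"
    using total_degree_second_deriv[of i j p] by simp
  then show ?thesis
    using that ij m(1) by (auto simp: vars_def)
qed

lemma mle_props:
  shows multilinear_mle: "multilinear (mle n f)"
    and vars_mle: "vars (mle n f) \<subseteq> {1..n}"
    and poly_eval_mle: "S \<subseteq> {1..n} \<Longrightarrow> poly_eval (mle n f) (indicator S) = f S"
  using is_mle_mle[of n f] by (auto simp: is_mle_def carrier_poly_ring)

lemma vars_second_deriv_mle:
  "vars (partial_deriv i (partial_deriv j (mle n f))) \<subseteq> {1..n} - {i, j}"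
  using vars_partial_deriv[OF multilinear_partial_deriv[OF multilinear_mle[of n f]], of i j]
    vars_partial_deriv[OF multilinear_mle[of n f], of j] vars_mle[of n f] by blast

lemma poly_eval_second_deriv_mle:
  assumes "i \<in> {1..n}" "j \<in> {1..n}" "i \<noteq> j" "T \<subseteq> {1..n} - {i, j}"
  shows "poly_eval (- partial_deriv i (partial_deriv j (mle n f))) (indicator T)
    = f (insert i T) + f (insert j T) - f (insert i (insert j T)) - f T"
proof -
  have "finite T" "i \<notin> T" "j \<notin> T" "j \<notin> insert i T" "T \<subseteq> {1..n}"
    using assms finite_subset[of T "{1..n}"] by auto
  then show ?thesis
    using assms(1,2)
    by (simp add: poly_eval_partial_deriv multilinear_partial_deriv multilinear_mle poly_eval_mle
        insert_commute[of j i])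
qed


section \<open>Submodularity from second differences\<close>

text \<open>The local inequalities say that adding one element \<open>j\<close> lowers the marginal value of \<open>i\<close>. Hence
  marginal values decrease as the set grows, and summing them along an enumeration of \<open>S - T\<close>
  compares the step from \<open>T\<close> to \<open>S \<union> T\<close> with the one from \<open>S \<inter> T\<close> to \<open>S\<close>.\<close>

lemma submodular_if_second_differences:
  assumes local: "\<And>i j T. i \<in> {1..n} \<Longrightarrow> j \<in> {1..n} \<Longrightarrow> i \<noteq> j \<Longrightarrow> T \<subseteq> {1..n} - {i, j} \<Longrightarrow>
      f (insert i (insert j T)) + f T \<le> f (insert i T) + f (insert j T)"
  shows "submodular n f"
proof -
  have marginal: "f (insert i (X \<union> D)) - f (X \<union> D) \<le> f (insert i X) - f X"
    if "finite D" "X \<union> D \<subseteq> {1..n} - {i}" "i \<in> {1..n}" for i X D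
    using that
  proof (induction D rule: finite_induct)
    case (insert j D)
    show ?case
    proof (cases "j \<in> X \<union> D")
      case True
      then have "X \<union> insert j D = X \<union> D" by blast
      with insert show ?thesis by simp
    next
      case False
      then have "f (insert i (insert j (X \<union> D))) + f (X \<union> D)
          \<le> f (insert i (X \<union> D)) + f (insert j (X \<union> D))"
        using insert.prems by (intro local) auto
      moreover have "f (insert i (X \<union> D)) - f (X \<union> D) \<le> f (insert i X) - f X"
        using insert by simp
      ultimately show ?thesis by simp
    qed
  qed simp
  have increment: "f (Y \<union> D) - f Y \<le> f (X \<union> D) - f X"
    if "finite D" "X \<subseteq> Y" "Y \<subseteq> {1..n}" "D \<subseteq> {1..n} - Y" for X Y D
    using that
  proof (induction D rule: finite_induct)
    case (insert i D)
    have "finite Y" using insert.prems finite_subset by blast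
    then have "f (insert i ((X \<union> D) \<union> Y)) - f ((X \<union> D) \<union> Y) \<le> f (insert i (X \<union> D)) - f (X \<union> D)"
      using insert by (intro marginal) auto
    moreover have "(X \<union> D) \<union> Y = Y \<union> D" using insert.prems by blast
    ultimately show ?case using insert by simp
  qed simp
  show ?thesis
    unfolding submodular_def
  proof (intro allI impI)
    fix S T assume ST: "S \<subseteq> {1..n}" "T \<subseteq> {1..n}"
    have "f (T \<union> (S - T)) - f T \<le> f ((S \<inter> T) \<union> (S - T)) - f (S \<inter> T)"
      using ST finite_subset[of S "{1..n}"] by (intro increment) auto
    moreover have "T \<union> (S - T) = S \<union> T" "(S \<inter> T) \<union> (S - T) = S" by auto
    ultimately show "f (S \<union> T) + f (S \<inter> T) \<le> f S + f T" by simp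
  qed
qed

lemma sos_submodular_imp_submodular:
  assumes "sos_submodular n t f"
  shows "submodular n f"
proof (rule submodular_if_second_differences)
  fix i j T assume ij: "i \<in> {1..n}" "j \<in> {1..n}" "i \<noteq> j" "T \<subseteq> {1..n} - {i, j}"
  let ?V = "{1..n} - {i, j}"
  let ?p = "- partial_deriv i (partial_deriv j (mle n f))"
  obtain m :: nat and q where "?p - (\<Sum>r=1..m. q r ^ 2) \<in> I2 ?V"
    using assms ij unfolding sos_submodular_def sos_mod_def by blast
  then have "poly_eval ?p (indicator T) = (\<Sum>r=1..m. poly_eval (q r) (indicator T) ^ 2)"
    using I2_vanishes[of _ ?V T] by fastforce
  then have "0 \<le> poly_eval ?p (indicator T)"
    by (simp add: sum_nonneg del: poly_eval_uminus)
  then show "f (insert i (insert j T)) + f T \<le> f (insert i T) + f (insert j T)"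
    unfolding poly_eval_second_deriv_mle[OF ij] by simp
qed

lemma submodular_imp_sos_submodular:
  assumes "submodular n f" "n + set_function_degree n f \<le> 2 * t + 5"
  shows "sos_submodular n t f"
  unfolding sos_submodular_def
proof (intro ballI impI)
  fix i j assume ij: "i \<in> {1..n}" "j \<in> {1..n}" "i \<noteq> j"
  let ?V = "{1..n} - {i, j}"
  let ?p = "- partial_deriv i (partial_deriv j (mle n f))"
  let ?d = "set_function_degree n f"
  have card_V: "card ?V + 2 = n"
    using ij card_mono[of "{1..n}" "{i, j}"] card_Diff_subset[of "{i, j}" "{1..n}"] by auto
  have vars: "vars ?p \<subseteq> ?V"
    using vars_second_deriv_mle by simp
  show "sos_mod ?V (I2 ?V) t ?p"
  \<comment> \<open>For \<open>d < 2\<close> the degree \<open>d - 2\<close> would be truncated to \<open>0\<close>, and the bound on \<open>t\<close> would be too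
    weak; but then the derivative is zero.\<close>
  proof (cases "?d < 2")
    case True
    then have "?p = 0"
      using second_deriv_zero by (simp add: set_function_degree_def)
    then show ?thesis
      by (intro sos_modI[of _ _ "{}"]) auto
  next
    case False
    show ?thesis
    proof (rule nonneg_on_cube_sos_mod[OF _ vars])
      show "total_degree ?p \<le> ?d - 2"
        using total_degree_second_deriv[of i j "mle n f"] by (simp add: set_function_degree_def)
      show "card ?V + (?d - 2) \<le> 2 * t + 1"
        using False assms(2) card_V by simp
    next
      fix T assume T: "T \<subseteq> ?V"
      have "f (insert i T \<union> insert j T) + f (insert i T \<inter> insert j T) \<le> f (insert i T) + f (insert j T)"
        using assms(1) ij T unfolding submodular_def by (meson Diff_subset insert_subset order_trans)
      moreover have "insert i T \<union> insert j T = insert i (insert j T)" "insert i T \<inter> insert j T = T"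
        using ij T by auto
      ultimately show "0 \<le> poly_eval ?p (indicator T)"
        unfolding poly_eval_second_deriv_mle[OF ij T] by simp
    qed simp
  qed
qed

lemma sos_submodular_degree:
  assumes "sos_submodular n t f"
  shows "set_function_degree n f \<le> 2 * t + 2"
proof (rule ccontr)
  assume large: "\<not> ?thesis"
  then have "2 \<le> total_degree (mle n f)"
    by (simp add: set_function_degree_def)
  then obtain i j where ij: "i \<in> vars (mle n f)" "j \<in> vars (mle n f)" "i \<noteq> j"
    and deg: "total_degree (partial_deriv i (partial_deriv j (mle n f))) = total_degree (mle n f) - 2"
    using second_deriv_degree_attained[OF multilinear_mle] by blast
  let ?p = "- partial_deriv i (partial_deriv j (mle n f))"
  have "sos_mod ({1..n} - {i, j}) (I2 ({1..n} - {i, j})) t ?p"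
    using assms ij vars_mle[of n f] unfolding sos_submodular_def by blast
  moreover have "multilinear ?p"
    using multilinear_partial_deriv[OF multilinear_partial_deriv[OF multilinear_mle]]
    by (simp add: multilinear_def)
  ultimately have "total_degree ?p \<le> 2 * t"
    by (intro sos_mod_degree)
  then show False
    using large deg by (simp add: set_function_degree_def)
qed

theorem proposition5:
  fixes t n d :: nat
  shows "(\<forall>f\<in>set_functions n. set_function_degree n f = d \<longrightarrow>
            int t < \<lceil>(real d - 2) / 2\<rceil> \<longrightarrow> \<not> sos_submodular n t f) \<and>
         (int t = \<lceil>(real n + real d - 5) / 2\<rceil> \<longrightarrow>
            {f \<in> set_functions n. set_function_degree n f = d \<and> sos_submodular n t f} =
            {f \<in> set_functions n. set_function_degree n f = d \<and> submodular n f})"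
proof (intro conjI impI ballI notI)
  fix f assume f: "set_function_degree n f = d" "int t < \<lceil>(real d - 2) / 2\<rceil>" "sos_submodular n t f"
  from f(2) have "real_of_int (int t) < (real d - 2) / 2"
    unfolding less_ceiling_iff .
  then have "real (2 * t + 2) < real d" by simp
  then have "2 * t + 2 < d" by (simp only: of_nat_less_iff)
  then show False
    using sos_submodular_degree[OF f(3)] f(1) by simp
next
  assume "int t = \<lceil>(real n + real d - 5) / 2\<rceil>"
  then have "(real n + real d - 5) / 2 \<le> real t"
    by (metis le_of_int_ceiling of_int_of_nat_eq)
  then have "real (n + d) \<le> real (2 * t + 5)" by simp
  then have "n + d \<le> 2 * t + 5" by (simp only: of_nat_le_iff)
  then show "{f \<in> set_functions n. set_function_degree n f = d \<and> sos_submodular n t f} =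
      {f \<in> set_functions n. set_function_degree n f = d \<and> submodular n f}"
    using sos_submodular_imp_submodular submodular_imp_sos_submodular by blast
qed

end
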